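(* Let $\alpha>0$ and let $X_\alpha=\{X_\alpha(t),t\in[0,1]\}$ be an $\alpha$-permanental process, with continuous sample paths, with kernel $u(s,t)$ and sigma function $\sigma(s,t)$. Suppose there is an increasing function $\varphi$ such that $\sigma(s,t)\le\varphi(|t-s|)$ for all $s,t\in[0,1]$ and $$\int_0^{1/2}\frac{\varphi(u)}{u(\log 1/u)^{1/2}}\,du<\infty.$$ Assume furthermore that $\varphi$ is regularly varying at zero with positive index. Then $$\limsup_{h\to0}\sup_{\substack{|s-t|\le h\\ s,t\in[0,1]}}\frac{|X_\alpha(s)-X_\alpha(t)|}{\varphi(h)(\log 1/h)^{1/2}}\le 2\sup_{t\in[0,1]}X_\alpha^{1/2}(t)\qquad a.s.$$
   Context: For $\alpha>0$, a random vector $(X_1,\dots,X_n)$ with nonnegative components is $\alpha$-permanental with kernel $U$ (a real $n\times n$ matrix) if $E\big(e^{-\sum_{i=1}^n s_iX_i}\big)=|I+US|^{-\alpha}$ for every diagonal matrix $S$ with positive diagonal entries $s_1,\dots,s_n$, where $|\cdot|$ denotes the determinant. A stochastic process $\{X_\alpha(t),t\in\mathcal T\}$ is an $\alpha$-permanental process with kernel $\{u(s,t),s,t\in\mathcal T\}$ if for all $t_1,\dots,t_n\in\mathcal T$ the vector $(X_\alpha(t_1),\dots,X_\alpha(t_n))$ is $\alpha$-permanental with kernel $\{u(t_i,t_j)\}_{i,j=1}^n$. Its sigma function is $\sigma(s,t)=\big(u(s,s)+u(t,t)-2(u(s,t)u(t,s))^{1/2}\big)^{1/2}$ (all quantities under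 the square roots are known to be nonnegative). Standing assumption on kernels: $\sup_{t\le\delta}u(t,t)>0$ for all $\delta>0$. *)

theory Defs
  imports "HOL-Probability.Probability" "Jordan_Normal_Form.Determinant"
begin

(* The components are X i for i < n.  The paper's |I + U S| is required to be positive because
   the real power is meant with a positive base, whereas powr is defined via ln and ln (- x) = ln x.
   This costs nothing: the left-hand side of the identity lies in (0, 1], so |I + U S| cannot
   vanish and, as S tends to 0, it tends to 1. *)
definition permanental_vector ::
  "'w measure \<Rightarrow> real \<Rightarrow> nat \<Rightarrow> (nat \<Rightarrow> 'w \<Rightarrow> real) \<Rightarrow> real mat \<Rightarrow> bool" where
  "permanental_vector M \<alpha> n X U \<longleftrightarrow>
     U \<in> carrier_mat n n \<and>
     (\<forall>i<n. X i \<in> borel_measurable M \<and> (AE \<omega> in M. 0 \<le> X i \<omega>)) \<and>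
     (\<forall>s :: nat \<Rightarrow> real. (\<forall>i<n. 0 < s i) \<longrightarrow>
        0 < Determinant.det (1\<^sub>m n + U * mat_diag n s) \<and>
        (\<integral>\<omega>. exp (- (\<Sum>i<n. s i * X i \<omega>)) \<partial>M)
          = Determinant.det (1\<^sub>m n + U * mat_diag n s) powr (- \<alpha>))"

definition permanental_process ::
  "'w measure \<Rightarrow> real \<Rightarrow> 't set \<Rightarrow> ('t \<Rightarrow> 'w \<Rightarrow> real) \<Rightarrow> ('t \<Rightarrow> 't \<Rightarrow> real) \<Rightarrow> bool" where
  "permanental_process M \<alpha> T X u \<longleftrightarrow>
     (\<forall>n. \<forall>t :: nat \<Rightarrow> 't. (\<forall>i<n. t i \<in> T) \<longrightarrow>
        permanental_vector M \<alpha> n (\<lambda>i. X (t i)) (Matrix.mat n n (\<lambda>(i, j). u (t i) (t j))))"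

definition sigma_function :: "('t \<Rightarrow> 't \<Rightarrow> real) \<Rightarrow> 't \<Rightarrow> 't \<Rightarrow> real" where
  "sigma_function u s t = sqrt (u s s + u t t - 2 * sqrt (u s t * u t s))"

(* Regular variation usually includes measurability; for the monotone functions
   considered here it is automatic. *)
definition regularly_varying_at_zero :: "(real \<Rightarrow> real) \<Rightarrow> real \<Rightarrow> bool" where
  "regularly_varying_at_zero f \<rho> \<longleftrightarrow>
     eventually (\<lambda>x. 0 < f x) (at_right 0) \<and>
     (\<forall>c>0. ((\<lambda>x. f (c * x) / f x) \<longlongrightarrow> c powr \<rho>) (at_right 0))"

end

theory Submission
  imports Defs "HOL-Real_Asymp.Real_Asymp"
begin

text \<open>Write \<open>R t = sqrt (X t)\<close>. Since \<open>\<bar>X s - X t\<bar> = \<bar>R s - R t\<bar> * (R s + R t)\<close>, it is enough to show that \<open>R\<close>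
has \<open>\<phi> h * sqrt (ln (1 / h))\<close> as a uniform modulus of continuity with constant 1; the factor \<open>R s + R t\<close>
accounts for the right-hand side of the theorem.

The probabilistic input is a Gaussian tail bound for one increment, with the sharp rate and uniform in the
kernel: for every \<open>\<epsilon>\<close> in \<open>(0, 1)\<close>,
\<open>P (R s > R t + a) \<le> \<epsilon> powr (- 2 * \<alpha>) * exp (- (1 - \<epsilon>) * a\<^sup>2 / \<sigma>\<^sup>2)\<close> with \<open>\<sigma> = \<sigma> (s, t)\<close>
(\<open>permanental_increment_one_sided\<close>). For \<open>\<alpha> = 1/2\<close> and a covariance kernel \<open>R\<close> is distributed as \<open>\<bar>G\<bar> / sqrt 2\<close> for a
Gaussian process \<open>G\<close> and the bound is classical. In general the joint Laplace transform of \<open>X s\<close> and \<open>X t\<close>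
depends on the kernel only through its diagonal entries \<open>u\<close>, \<open>v\<close> and the product \<open>w\<close> of the off-diagonal
ones, and for \<open>0 \<le> w < u * v\<close> it belongs to an explicit law: one component is Gamma, and given
its value \<open>y\<close> the other one is Gamma with a Poisson-distributed increase of the shape, of mean proportional to
\<open>y\<close> (\<open>bivariate_gamma_laplace\<close>). A Chernoff bound for the conditional law, integrated over \<open>y\<close>, gives the estimate;
completing a square produces exactly \<open>u + v - 2 * sqrt w = \<sigma>\<^sup>2\<close> (\<open>bivariate_gamma_tail\<close>). That the pair
\<open>(X s, X t)\<close> inherits the estimate from the explicit law, also in degenerate cases, follows from a continuity
theorem for Laplace transforms (\<open>exp_integral_tendsto\<close>).

The passage to the modulus is the argument for Gaussian processes. By Borel-Cantelli, almost surely all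
increments of \<open>R\<close> over at most \<open>2 * K\<close> steps of a fine dyadic grid satisfy the desired bound up to a factor
\<open>e > 1\<close> (\<open>dyadic_increments_AE\<close>). Points at distance at most \<open>h\<close> are compared with their neighbours
in a grid of mesh about \<open>h / K\<close>, and the remaining errors are summed along dyadic chains
(\<open>dyadic_modulus\<close>). As \<open>\<phi>\<close> is regularly varying with positive index \<open>\<rho>\<close>, \<open>\<phi>\<close> decays geometrically along
a chain and the chaining error is of order \<open>K powr - \<rho>\<close> relative to the main term, hence negligible for large
\<open>K\<close> (\<open>regular_modulus\<close>).\<close>

section \<open>Gamma laws with a random shape\<close>

definition gamma_pdf :: "real \<Rightarrow> real \<Rightarrow> real \<Rightarrow> real" where
  "gamma_pdf \<beta> c x = (if 0 \<le> x then x powr (\<beta> - 1) * exp (- x / c) / (Gamma \<beta> * c powr \<beta>) else 0)"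

lemma gamma_pdf_measurable [measurable]: "gamma_pdf \<beta> c \<in> borel_measurable borel"
  unfolding gamma_pdf_def by measurable

lemma gamma_pdf_nonneg: "0 < \<beta> \<Longrightarrow> 0 \<le> gamma_pdf \<beta> c x"
  unfolding gamma_pdf_def by (auto intro!: divide_nonneg_nonneg mult_nonneg_nonneg Gamma_real_nonneg)

text \<open>The moment generating function of the Gamma law with shape \<open>\<beta>\<close> and scale \<open>c\<close>, computed by
rescaling the integral for \<open>Gamma \<beta>\<close>. It is used with negative \<open>t\<close> for Laplace transforms and with
positive \<open>t\<close> for Chernoff bounds.\<close>

lemma gamma_pdf_mgf:
  assumes \<beta>: "0 < \<beta>" and c: "0 < c" and t: "c * t < 1"
  shows "(\<integral>\<^sup>+x. ennreal (gamma_pdf \<beta> c x * exp (t * x)) \<partial>lborel) = ennreal ((1 - c * t) powr - \<beta>)"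
proof -
  define d where "d = c / (1 - c * t)"
  have d: "0 < d" using c t by (simp add: d_def)
  have G: "0 < Gamma \<beta>" using \<beta> by (rule Gamma_real_pos)
  have "(\<integral>\<^sup>+x. ennreal (gamma_pdf \<beta> c x * exp (t * x)) \<partial>lborel)
      = \<bar>d\<bar> * (\<integral>\<^sup>+x. ennreal (gamma_pdf \<beta> c (0 + d * x) * exp (t * (0 + d * x))) \<partial>lborel)"
    by (rule nn_integral_real_affine) (use d in auto)
  also have "\<dots> = (\<integral>\<^sup>+x. ennreal \<bar>d\<bar> * ennreal (gamma_pdf \<beta> c (0 + d * x) * exp (t * (0 + d * x))) \<partial>lborel)"
    by (rule nn_integral_cmult [symmetric]) measurable
  also have "\<dots> = (\<integral>\<^sup>+x. ennreal ((1 - c * t) powr - \<beta> / Gamma \<beta>) *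
                         ennreal (indicator {0..} x * x powr (\<beta> - 1) / exp x) \<partial>lborel)"
  proof (rule nn_integral_cong)
    fix x :: real
    have "d * (gamma_pdf \<beta> c (d * x) * exp (t * (d * x)))
        = (1 - c * t) powr - \<beta> / Gamma \<beta> * (indicator {0..} x * x powr (\<beta> - 1) / exp x)"
    proof (cases "0 \<le> x")
      case True
      have e: "exp (- (d * x) / c) * exp (t * (d * x)) = 1 / exp x"
      proof -
        have "- (d * x) / c = - (x / (1 - c * t))" and "t * (d * x) = c * t * (x / (1 - c * t))"
          using c by (simp_all add: d_def)
        moreover have "- y + k * y = - ((1 - k) * y)" for y k :: real
          by (simp add: algebra_simps)
        ultimately have "- (d * x) / c + t * (d * x) = - ((1 - c * t) * (x / (1 - c * t)))"
          by (simp only:)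
        hence "- (d * x) / c + t * (d * x) = - x"
          using t by simp
        thus ?thesis by (simp add: exp_add [symmetric] exp_minus field_simps)
      qed
      have p: "d * (d * x) powr (\<beta> - 1) / c powr \<beta> = (1 - c * t) powr - \<beta> * x powr (\<beta> - 1)"
      proof -
        have "d * (d * x) powr (\<beta> - 1) = d powr \<beta> * x powr (\<beta> - 1)"
          using d True by (simp add: powr_mult powr_diff)
        moreover have "d powr \<beta> = c powr \<beta> * (1 - c * t) powr - \<beta>"
          using c t by (simp add: d_def powr_divide powr_minus_divide)
        ultimately show ?thesis using c by simp
      qed
      have "d * (gamma_pdf \<beta> c (d * x) * exp (t * (d * x)))
          = (d * (d * x) powr (\<beta> - 1) / c powr \<beta>) * (exp (- (d * x) / c) * exp (t * (d * x))) / Gamma \<beta>"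
        using True d by (simp add: gamma_pdf_def mult_ac)
      also have "\<dots> = (1 - c * t) powr - \<beta> / Gamma \<beta> * (indicator {0..} x * x powr (\<beta> - 1) / exp x)"
        using True unfolding e p by simp
      finally show ?thesis .
    next
      case False
      hence "d * x < 0" using d by (simp add: mult_less_0_iff)
      thus ?thesis using False by (simp add: gamma_pdf_def)
    qed
    thus "ennreal \<bar>d\<bar> * ennreal (gamma_pdf \<beta> c (0 + d * x) * exp (t * (0 + d * x)))
        = ennreal ((1 - c * t) powr - \<beta> / Gamma \<beta>) * ennreal (indicator {0..} x * x powr (\<beta> - 1) / exp x)"
      using d G gamma_pdf_nonneg[OF \<beta>] by (subst (1 2) ennreal_mult [symmetric]) auto
  qed
  also have "\<dots> = ennreal ((1 - c * t) powr - \<beta> / Gamma \<beta>) * ennreal (Gamma \<beta>)"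
    by (subst nn_integral_cmult) (auto simp: Gamma_conv_nn_integral_real[OF \<beta>])
  also have "\<dots> = ennreal ((1 - c * t) powr - \<beta>)"
    using G by (subst ennreal_mult [symmetric]) auto
  finally show ?thesis .
qed

text \<open>The density of a Gamma variable with scale \<open>c\<close> whose shape is \<open>\<alpha>\<close> plus a Poisson variable of
mean \<open>l\<close>: a noncentral chi-square law, up to scaling. This is the conditional law of one component of a
bivariate permanental vector given the other one.\<close>

definition poisson_gamma_pdf :: "real \<Rightarrow> real \<Rightarrow> real \<Rightarrow> real \<Rightarrow> ennreal" where
  "poisson_gamma_pdf \<alpha> c l x =
     (\<Sum>N. ennreal (l ^ N / fact N * exp (- l)) * ennreal (gamma_pdf (\<alpha> + real N) c x))"

text \<open>Each unit of shape contributes a factor \<open>1 / (1 - c * t)\<close>, so the mixture over the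
Poisson weights is an exponential series.\<close>

lemma poisson_gamma_pdf_mgf:
  assumes \<alpha>: "0 < \<alpha>" and c: "0 < c" and l: "0 \<le> l" and t: "c * t < 1"
  shows "(\<integral>\<^sup>+x. poisson_gamma_pdf \<alpha> c l x * ennreal (exp (t * x)) \<partial>lborel)
       = ennreal ((1 - c * t) powr - \<alpha> * exp (l * (1 / (1 - c * t) - 1)))"
proof -
  define q where "q = 1 - c * t"
  have q: "0 < q" using t by (simp add: q_def)
  have "(\<integral>\<^sup>+x. poisson_gamma_pdf \<alpha> c l x * ennreal (exp (t * x)) \<partial>lborel)
      = (\<integral>\<^sup>+x. (\<Sum>N. ennreal (l ^ N / fact N * exp (- l)) *
                   ennreal (gamma_pdf (\<alpha> + real N) c x * exp (t * x))) \<partial>lborel)"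
    unfolding poisson_gamma_pdf_def using \<alpha>
    by (intro nn_integral_cong)
       (simp add: ennreal_mult'' ennreal_suminf_multc [symmetric] mult.assoc)
  also have "\<dots> = (\<Sum>N. \<integral>\<^sup>+x. ennreal (l ^ N / fact N * exp (- l)) *
                   ennreal (gamma_pdf (\<alpha> + real N) c x * exp (t * x)) \<partial>lborel)"
    by (rule nn_integral_suminf) measurable
  also have "\<dots> = (\<Sum>N. ennreal (l ^ N / fact N * exp (- l)) * ennreal (q powr - (\<alpha> + real N)))"
  proof (rule arg_cong [where f = suminf], rule ext)
    fix N
    show "(\<integral>\<^sup>+x. ennreal (l ^ N / fact N * exp (- l)) *
                   ennreal (gamma_pdf (\<alpha> + real N) c x * exp (t * x)) \<partial>lborel)
        = ennreal (l ^ N / fact N * exp (- l)) * ennreal (q powr - (\<alpha> + real N))"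
      unfolding q_def using \<alpha> c t
      by (subst nn_integral_cmult) (auto simp: gamma_pdf_mgf)
  qed
  also have "\<dots> = (\<Sum>N. ennreal (exp (- l) * q powr - \<alpha> * ((l / q) ^ N /\<^sub>R fact N)))"
  proof (rule arg_cong [where f = suminf], rule ext)
    fix N
    have "l ^ N / fact N * exp (- l) * q powr - (\<alpha> + real N) = exp (- l) * q powr - \<alpha> * ((l / q) ^ N /\<^sub>R fact N)"
      using q by (simp add: powr_diff powr_realpow field_simps powr_minus powr_add)
    thus "ennreal (l ^ N / fact N * exp (- l)) * ennreal (q powr - (\<alpha> + real N))
        = ennreal (exp (- l) * q powr - \<alpha> * ((l / q) ^ N /\<^sub>R fact N))"
      using l by (subst ennreal_mult [symmetric]) auto
  qed
  also have "\<dots> = ennreal (exp (- l) * q powr - \<alpha> * exp (l / q))"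
    using l q by (intro suminf_ennreal_eq sums_mult exp_converges) auto
  also have "exp (- l) * q powr - \<alpha> * exp (l / q) = q powr - \<alpha> * exp (l * (1 / q - 1))"
    by (simp add: exp_add [symmetric] algebra_simps mult_exp_exp)
  finally show ?thesis unfolding q_def .
qed

lemma poisson_gamma_pdf_measurable [measurable]:
  assumes [measurable]: "f \<in> borel_measurable M" "g \<in> borel_measurable M"
  shows "(\<lambda>z. poisson_gamma_pdf \<alpha> c (f z) (g z)) \<in> borel_measurable M"
  unfolding poisson_gamma_pdf_def by measurable

lemma poisson_gamma_pdf_neg: "x < 0 \<Longrightarrow> poisson_gamma_pdf \<alpha> c l x = 0"
  by (simp add: poisson_gamma_pdf_def gamma_pdf_def)

text \<open>A Chernoff bound with the correct exponential rate. With \<open>\<theta> = 1 - c * t\<close> the exponent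
is \<open>- (1 - \<theta>) * (b\<^sup>2 - z\<^sup>2 / \<theta>) / c\<close>, optimal at \<open>\<theta> = z / b\<close> with value \<open>- (b - z)\<^sup>2 / c\<close>. The
prefactor \<open>\<theta> powr - \<alpha>\<close> would be unbounded for small \<open>z / b\<close>; cutting \<open>\<theta>\<close> off at \<open>\<epsilon>\<close> makes it uniform
at the cost of a factor \<open>1 - \<epsilon>\<close> in the exponent.\<close>

lemma poisson_gamma_tail:
  assumes \<alpha>: "0 < \<alpha>" and c: "0 < c" and z: "0 \<le> z" and zb: "z < b" and \<epsilon>: "0 < \<epsilon>" "\<epsilon> < 1"
  shows "(\<integral>\<^sup>+x. poisson_gamma_pdf \<alpha> c (z\<^sup>2 / c) x * indicator {b\<^sup>2..} x \<partial>lborel)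
       \<le> ennreal (\<epsilon> powr - \<alpha> * exp (- (1 - \<epsilon>) * (b - z)\<^sup>2 / c))"
proof -
  define \<theta> where "\<theta> = max \<epsilon> (z / b)"
  define p where "p = (1 - \<theta>) / c"
  have b: "0 < b" using z zb by simp
  have \<theta>: "\<epsilon> \<le> \<theta>" "0 < \<theta>" "\<theta> < 1" using \<epsilon> zb b by (auto simp: \<theta>_def)
  have cp: "1 - c * p = \<theta>" using c by (simp add: p_def)
  have p0: "0 \<le> p" using \<theta> c by (simp add: p_def)
  have key: "(1 - \<epsilon>) * (b - z)\<^sup>2 \<le> (1 - \<theta>) * (b\<^sup>2 - z\<^sup>2 / \<theta>)"
  proof (cases "\<epsilon> \<le> z / b")
    case True
    hence th: "\<theta> = z / b" by (simp add: \<theta>_def)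
    have z0: "0 < z" using th \<theta> b by (simp add: zero_less_divide_iff)
    have "(1 - \<theta>) * (b\<^sup>2 - z\<^sup>2 / \<theta>) = (b - z)\<^sup>2"
      using b z0 unfolding th by (simp add: field_simps power2_eq_square)
    moreover have "(1 - \<epsilon>) * (b - z)\<^sup>2 \<le> 1 * (b - z)\<^sup>2"
      using \<epsilon> by (intro mult_right_mono) auto
    ultimately show ?thesis by simp
  next
    case False
    hence th: "\<theta> = \<epsilon>" by (simp add: \<theta>_def)
    have "z \<le> \<epsilon> * b" using False b by (simp add: field_simps)
    hence "z * z \<le> z * (\<epsilon> * b)" using z by (rule mult_left_mono)
    hence "z\<^sup>2 / \<epsilon> \<le> z * b" using \<epsilon> by (simp add: field_simps power2_eq_square)
    moreover have "z * z \<le> z * b" using z zb by (intro mult_left_mono) auto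
    ultimately have "(b - z)\<^sup>2 \<le> b\<^sup>2 - z\<^sup>2 / \<epsilon>" by (simp add: power2_eq_square algebra_simps)
    thus ?thesis unfolding th using \<epsilon> by (intro mult_left_mono) auto
  qed
  have "(\<integral>\<^sup>+x. poisson_gamma_pdf \<alpha> c (z\<^sup>2 / c) x * indicator {b\<^sup>2..} x \<partial>lborel)
      \<le> (\<integral>\<^sup>+x. ennreal (exp (- p * b\<^sup>2)) * (poisson_gamma_pdf \<alpha> c (z\<^sup>2 / c) x * ennreal (exp (p * x))) \<partial>lborel)"
  proof (rule nn_integral_mono)
    fix x :: real
    have "indicator {b\<^sup>2..} x \<le> ennreal (exp (- p * b\<^sup>2)) * ennreal (exp (p * x))"
    proof (cases "b\<^sup>2 \<le> x")
      case True
      hence "p * b\<^sup>2 \<le> p * x" using p0 by (rule mult_left_mono)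
      hence "1 \<le> exp (- p * b\<^sup>2) * exp (p * x)" by (simp add: mult_exp_exp)
      thus ?thesis using True by (subst ennreal_mult [symmetric]) auto
    qed auto
    from mult_left_mono [OF this, of "poisson_gamma_pdf \<alpha> c (z\<^sup>2 / c) x"]
    show "poisson_gamma_pdf \<alpha> c (z\<^sup>2 / c) x * indicator {b\<^sup>2..} x \<le>
      ennreal (exp (- p * b\<^sup>2)) * (poisson_gamma_pdf \<alpha> c (z\<^sup>2 / c) x * ennreal (exp (p * x)))"
      by (simp add: mult_ac)
  qed
  also have "\<dots> = ennreal (exp (- p * b\<^sup>2)) * ennreal (\<theta> powr - \<alpha> * exp (z\<^sup>2 / c * (1 / \<theta> - 1)))"
    using poisson_gamma_pdf_mgf [OF \<alpha> c, of "z\<^sup>2 / c" p] c cp \<theta>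
    by (subst nn_integral_cmult) auto
  also have "\<dots> = ennreal (\<theta> powr - \<alpha> * exp (- (1 - \<theta>) * (b\<^sup>2 - z\<^sup>2 / \<theta>) / c))"
  proof -
    have "- p * b\<^sup>2 + z\<^sup>2 / c * (1 / \<theta> - 1) = - (1 - \<theta>) * (b\<^sup>2 - z\<^sup>2 / \<theta>) / c"
      using \<theta> c by (simp add: p_def field_simps)
    thus ?thesis by (subst ennreal_mult [symmetric]) (auto simp: exp_add [symmetric] mult_ac)
  qed
  also have "\<dots> \<le> ennreal (\<epsilon> powr - \<alpha> * exp (- (1 - \<epsilon>) * (b - z)\<^sup>2 / c))"
    using \<theta> \<epsilon> \<alpha> divide_right_mono [OF key, of c] c
    by (intro ennreal_leI mult_mono powr_mono2' iffD2 [OF exp_le_cancel_iff])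
       (auto simp: minus_divide_left [symmetric] simp del: minus_diff_eq)
  finally show ?thesis .
qed

section \<open>An explicit bivariate permanental law\<close>

text \<open>Here \<open>c = (u * v - w) / v\<close> and \<open>d = 1 - sqrt w / v\<close> satisfy
\<open>c + v * d\<^sup>2 = u + v - 2 * sqrt w\<close>, the square of the sigma function, so the inequality is
Cauchy-Schwarz for \<open>a = (a + d * r) - d * r\<close>. Probabilistically: the cost of \<open>Y = r\<^sup>2\<close> plus the
conditional cost of \<open>sqrt X = r + a\<close> is at least \<open>a\<^sup>2 / \<tau>\<^sup>2\<close>.\<close>

lemma bivariate_rate:
  fixes u v w a r \<tau> :: real
  assumes v: "0 < v" and w: "0 \<le> w" and uv: "w < u * v" and \<tau>: "0 < \<tau>" "u + v - 2 * sqrt w \<le> \<tau>\<^sup>2"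
  shows "a\<^sup>2 / \<tau>\<^sup>2 \<le> (a + (1 - sqrt w / v) * r)\<^sup>2 / ((u * v - w) / v) + r\<^sup>2 / v" (is ?A)
proof -
  define c where "c = (u * v - w) / v"
  define d where "d = 1 - sqrt w / v"
  have c: "0 < c" using v uv by (simp add: c_def)
  have s: "c + v * d\<^sup>2 = u + v - 2 * sqrt w"
    using v w by (simp add: c_def d_def power2_eq_square field_simps)
  have "a\<^sup>2 \<le> ((a + d * r)\<^sup>2 / c + r\<^sup>2 / v) * (c + v * d\<^sup>2)"
  proof -
    have "((a + d * r)\<^sup>2 / c + r\<^sup>2 / v) * (c + v * d\<^sup>2) - a\<^sup>2 = (v * d * (a + d * r) / c + r)\<^sup>2 * c / v"
      using c v by (simp add: field_simps power2_eq_square)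
    moreover have "0 \<le> (v * d * (a + d * r) / c + r)\<^sup>2 * c / v" using c v by simp
    ultimately show ?thesis by linarith
  qed
  also have "\<dots> \<le> ((a + d * r)\<^sup>2 / c + r\<^sup>2 / v) * \<tau>\<^sup>2"
    unfolding s using \<tau> c v by (intro mult_left_mono) auto
  finally show ?A unfolding c_def [symmetric] d_def [symmetric] using \<tau> by (simp add: field_simps)
qed

text \<open>A realisation of the bivariate permanental law in the nondegenerate case \<open>0 \<le> w < u * v\<close>: the
second component is Gamma with scale \<open>v\<close>, and the first one is then drawn from the mixture above.\<close>

definition bivariate_gamma :: "real \<Rightarrow> real \<Rightarrow> real \<Rightarrow> real \<Rightarrow> (real \<times> real) measure" where
  "bivariate_gamma \<alpha> u v w = density (lborel \<Otimes>\<^sub>M lborel)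
     (\<lambda>(x, y). ennreal (gamma_pdf \<alpha> v y) * poisson_gamma_pdf \<alpha> ((u * v - w) / v) (w / v\<^sup>2 * y / ((u * v - w) / v)) x)"

lemma sets_bivariate_gamma [measurable_cong, simp]: "sets (bivariate_gamma \<alpha> u v w) = sets (borel \<Otimes>\<^sub>M borel)"
  by (simp add: bivariate_gamma_def)

lemma space_bivariate_gamma [simp]: "space (bivariate_gamma \<alpha> u v w) = UNIV"
  by (simp add: bivariate_gamma_def space_pair_measure)

lemma nn_integral_bivariate_gamma:
  assumes [measurable]: "F \<in> borel_measurable (borel \<Otimes>\<^sub>M borel)"
  shows "(\<integral>\<^sup>+z. F z \<partial>bivariate_gamma \<alpha> u v w) =
    (\<integral>\<^sup>+y. ennreal (gamma_pdf \<alpha> v y) * (\<integral>\<^sup>+x. poisson_gamma_pdf \<alpha> ((u * v - w) / v) (w / v\<^sup>2 * y / ((u * v - w) / v)) x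
        * F (x, y) \<partial>lborel) \<partial>lborel)"
proof -
  have "(\<integral>\<^sup>+z. F z \<partial>bivariate_gamma \<alpha> u v w) = 
     (\<integral>\<^sup>+z. (case z of (x, y) \<Rightarrow> ennreal (gamma_pdf \<alpha> v y) * poisson_gamma_pdf \<alpha> ((u * v - w) / v) (w / v\<^sup>2 * y / ((u * v - w) / v)) x)
        * F z \<partial>(lborel \<Otimes>\<^sub>M lborel))"
    unfolding bivariate_gamma_def by (rule nn_integral_density) measurable
  also have "\<dots> = (\<integral>\<^sup>+y. (\<integral>\<^sup>+x. ennreal (gamma_pdf \<alpha> v y) * poisson_gamma_pdf \<alpha> ((u * v - w) / v) (w / v\<^sup>2 * y / ((u * v - w) / v)) x
        * F (x, y) \<partial>lborel) \<partial>lborel)"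
    by (subst lborel_pair.nn_integral_snd [symmetric]) auto
  also have "\<dots> = (\<integral>\<^sup>+y. ennreal (gamma_pdf \<alpha> v y) * (\<integral>\<^sup>+x. poisson_gamma_pdf \<alpha> ((u * v - w) / v) (w / v\<^sup>2 * y / ((u * v - w) / v)) x
        * F (x, y) \<partial>lborel) \<partial>lborel)"
    by (intro nn_integral_cong) (simp add: nn_integral_cmult mult.assoc)
  finally show ?thesis .
qed

lemma bivariate_gamma_laplace:
  assumes \<alpha>: "0 < \<alpha>" and v: "0 < v" and w: "0 \<le> w" and uv: "w < u * v" and st: "0 \<le> s" "0 \<le> t"
  shows "(\<integral>\<^sup>+z. ennreal (exp (- (s * fst z + t * snd z))) \<partial>bivariate_gamma \<alpha> u v w)
       = ennreal ((1 + u * s + v * t + (u * v - w) * s * t) powr - \<alpha>)"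
proof -
  define c where "c = (u * v - w) / v"
  have c: "0 < c" using v uv by (simp add: c_def)
  define Q where "Q = 1 + c * s"
  have Q: "1 \<le> Q" using c st by (simp add: Q_def)
  define T where "T = w / v\<^sup>2 / c * (1 / Q - 1) - t"
  have "w / v\<^sup>2 / c * (1 / Q - 1) \<le> 0"
    using Q w c by (intro mult_nonneg_nonpos) auto
  hence T: "T \<le> 0" using st by (simp add: T_def)
  have "(\<integral>\<^sup>+z. ennreal (exp (- (s * fst z + t * snd z))) \<partial>bivariate_gamma \<alpha> u v w)
     = (\<integral>\<^sup>+y. ennreal (gamma_pdf \<alpha> v y) * (\<integral>\<^sup>+x. poisson_gamma_pdf \<alpha> c (w / v\<^sup>2 * y / c) x
        * ennreal (exp (- (s * x + t * y))) \<partial>lborel) \<partial>lborel)"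
    by (subst nn_integral_bivariate_gamma) (auto simp: c_def)
  also have "\<dots> = (\<integral>\<^sup>+y. ennreal (Q powr - \<alpha>) * ennreal (gamma_pdf \<alpha> v y * exp (T * y)) \<partial>lborel)"
  proof (rule nn_integral_cong)
    fix y :: real
    show "ennreal (gamma_pdf \<alpha> v y) * (\<integral>\<^sup>+x. poisson_gamma_pdf \<alpha> c (w / v\<^sup>2 * y / c) x
        * ennreal (exp (- (s * x + t * y))) \<partial>lborel) = ennreal (Q powr - \<alpha>) * ennreal (gamma_pdf \<alpha> v y * exp (T * y))"
    proof (cases "0 \<le> y")
      case True
      have "(\<integral>\<^sup>+x. poisson_gamma_pdf \<alpha> c (w / v\<^sup>2 * y / c) x * ennreal (exp (- (s * x + t * y))) \<partial>lborel)
        = (\<integral>\<^sup>+x. ennreal (exp (- t * y)) * (poisson_gamma_pdf \<alpha> c (w / v\<^sup>2 * y / c) x * ennreal (exp (- s * x))) \<partial>lborel)"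
      proof (rule nn_integral_cong)
        fix x
        have "ennreal (exp (- (s * x + t * y))) = ennreal (exp (- t * y)) * ennreal (exp (- s * x))"
          by (subst ennreal_mult [symmetric]) (auto simp: mult_exp_exp)
        thus "poisson_gamma_pdf \<alpha> c (w / v\<^sup>2 * y / c) x * ennreal (exp (- (s * x + t * y)))
          = ennreal (exp (- t * y)) * (poisson_gamma_pdf \<alpha> c (w / v\<^sup>2 * y / c) x * ennreal (exp (- s * x)))"
          by (simp add: mult_ac)
      qed
      also have "\<dots> = ennreal (exp (- t * y)) * ennreal (Q powr - \<alpha> * exp (w / v\<^sup>2 * y / c * (1 / Q - 1)))"
      proof -
        have "(\<integral>\<^sup>+x. poisson_gamma_pdf \<alpha> c (w / v\<^sup>2 * y / c) x * ennreal (exp (- s * x)) \<partial>lborel)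
           = ennreal ((1 - c * - s) powr - \<alpha> * exp (w / v\<^sup>2 * y / c * (1 / (1 - c * - s) - 1)))"
        proof (rule poisson_gamma_pdf_mgf [OF \<alpha> c])
          show "0 \<le> w / v\<^sup>2 * y / c" using True w c by simp
          have "0 \<le> c * s" using c st by simp
          thus "c * - s < 1" by (simp only: mult_minus_right)
        qed
        moreover have "1 - c * - s = Q" by (simp add: Q_def)
        ultimately show ?thesis by (subst nn_integral_cmult) auto
      qed
      also have "\<dots> = ennreal (Q powr - \<alpha> * exp (T * y))"
      proof -
        have "- t * y + w / v\<^sup>2 * y / c * (1 / Q - 1) = T * y" by (simp add: T_def algebra_simps)
        thus ?thesis by (subst ennreal_mult [symmetric]) (auto simp: mult_exp_exp mult_ac)
      qed
      finally show ?thesis using gamma_pdf_nonneg[OF \<alpha>]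
        by (simp add: ennreal_mult [symmetric] mult_ac)
    qed (simp add: gamma_pdf_def)
  qed
  also have "\<dots> = ennreal (Q powr - \<alpha>) * ennreal ((1 - v * T) powr - \<alpha>)"
  proof -
    have "v * T \<le> 0" using v T by (simp add: mult_nonneg_nonpos)
    thus ?thesis using gamma_pdf_mgf [OF \<alpha> v, of T] by (subst nn_integral_cmult) auto
  qed
  also have "\<dots> = ennreal ((Q * (1 - v * T)) powr - \<alpha>)"
  proof -
    have "v * T \<le> 0" using v T by (simp add: mult_nonneg_nonpos)
    thus ?thesis using Q by (subst ennreal_mult [symmetric]) (auto simp: powr_mult)
  qed
  also have "Q * (1 - v * T) = 1 + u * s + v * t + (u * v - w) * s * t"
  proof -
    have "Q * (1 - v * T) = Q + v * t * Q + w / v / c * (Q - 1)"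
      using Q v c by (simp add: T_def field_simps power2_eq_square)
    also have "w / v / c * (Q - 1) = w / v * s" using c by (simp add: Q_def)
    also have "Q + v * t * Q + w / v * s = 1 + u * s + v * t + (u * v - w) * s * t"
      using v by (simp add: Q_def c_def field_simps)
    finally show ?thesis .
  qed
  finally show ?thesis .
qed

text \<open>Integrating the conditional Chernoff bound against the Gamma law of \<open>y\<close>: by
\<open>bivariate_rate\<close> the conditional probability is at most a constant times
\<open>exp (- (1 - \<epsilon>) * (a\<^sup>2 / \<tau>\<^sup>2 - y / v))\<close>, and \<open>exp ((1 - \<epsilon>) * y / v)\<close> is integrable for the Gamma law of
scale \<open>v\<close>, with integral \<open>\<epsilon> powr - \<alpha>\<close>.\<close>

lemma bivariate_gamma_tail:
  assumes \<alpha>: "0 < \<alpha>" and v: "0 < v" and w: "0 \<le> w" and uv: "w < u * v"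
    and \<tau>: "0 < \<tau>" "u + v - 2 * sqrt w \<le> \<tau>\<^sup>2" and a: "0 < a" and \<epsilon>: "0 < \<epsilon>" "\<epsilon> < 1"
  shows "emeasure (bivariate_gamma \<alpha> u v w) {z. sqrt (snd z) + a \<le> sqrt (fst z)}
       \<le> ennreal (\<epsilon> powr (- 2 * \<alpha>) * exp (- (1 - \<epsilon>) * a\<^sup>2 / \<tau>\<^sup>2))"
proof -
  define c where "c = (u * v - w) / v"
  have c: "0 < c" using v uv by (simp add: c_def)
  let ?A = "{z :: real \<times> real. sqrt (snd z) + a \<le> sqrt (fst z)}"
  have A [measurable]: "?A \<in> sets (borel \<Otimes>\<^sub>M borel)"
  proof -
    have "{z \<in> space (borel \<Otimes>\<^sub>M borel). sqrt (snd z) + a \<le> sqrt (fst z :: real)} \<in> sets (borel \<Otimes>\<^sub>M borel)"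
      by measurable
    thus ?thesis by (simp add: space_pair_measure)
  qed
  let ?C = "ennreal (\<epsilon> powr - \<alpha> * exp (- (1 - \<epsilon>) * a\<^sup>2 / \<tau>\<^sup>2))"
  have inner: "(\<integral>\<^sup>+x. poisson_gamma_pdf \<alpha> c (w / v\<^sup>2 * y / c) x * indicator ?A (x, y) \<partial>lborel)
      \<le> ?C * ennreal (exp ((1 - \<epsilon>) / v * y))" if y: "0 \<le> y" for y
  proof -
    define r where "r = sqrt y"
    have r: "0 \<le> r" "y = r\<^sup>2" using y by (auto simp: r_def)
    define z where "z = sqrt w / v * r"
    have z: "0 \<le> z" "w / v\<^sup>2 * y = z\<^sup>2"
      using v w r by (auto simp: z_def power_mult_distrib power_divide)
    have C: "?C * ennreal (exp ((1 - \<epsilon>) / v * y)) = ennreal (\<epsilon> powr - \<alpha> * exp ((1 - \<epsilon>) * (r\<^sup>2 / v - a\<^sup>2 / \<tau>\<^sup>2)))"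
      by (subst ennreal_mult [symmetric]) (auto simp: r(2) mult_exp_exp algebra_simps add_divide_distrib diff_divide_distrib)
    show ?thesis
    proof (cases "z < r + a")
      case True
      have "(\<integral>\<^sup>+x. poisson_gamma_pdf \<alpha> c (w / v\<^sup>2 * y / c) x * indicator ?A (x, y) \<partial>lborel)
          \<le> (\<integral>\<^sup>+x. poisson_gamma_pdf \<alpha> c (z\<^sup>2 / c) x * indicator {(r + a)\<^sup>2..} x \<partial>lborel)"
      proof (rule nn_integral_mono)
        fix x :: real
        have "indicator ?A (x, y) \<le> (indicator {(r + a)\<^sup>2..} x :: ennreal)"
        proof (cases "r + a \<le> sqrt x")
          case T: True
          have "0 < sqrt x" using T r a by linarith
          hence "0 < x" by simp
          moreover have "(r + a)\<^sup>2 \<le> (sqrt x)\<^sup>2" using T r a by (intro power_mono) auto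
          ultimately show ?thesis by (simp add: indicator_def)
        qed (simp add: r_def)
        thus "poisson_gamma_pdf \<alpha> c (w / v\<^sup>2 * y / c) x * indicator ?A (x, y)
            \<le> poisson_gamma_pdf \<alpha> c (z\<^sup>2 / c) x * indicator {(r + a)\<^sup>2..} x"
          unfolding z(2) by (intro mult_left_mono) auto
      qed
      also have "\<dots> \<le> ennreal (\<epsilon> powr - \<alpha> * exp (- (1 - \<epsilon>) * (r + a - z)\<^sup>2 / c))"
        by (rule poisson_gamma_tail [OF \<alpha> c z(1) True \<epsilon>])
      also have "\<dots> \<le> ennreal (\<epsilon> powr - \<alpha> * exp ((1 - \<epsilon>) * (r\<^sup>2 / v - a\<^sup>2 / \<tau>\<^sup>2)))"
      proof (intro ennreal_leI mult_left_mono iffD2 [OF exp_le_cancel_iff])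
        have "r + a - z = a + (1 - sqrt w / v) * r" by (simp add: z_def algebra_simps)
        hence "a\<^sup>2 / \<tau>\<^sup>2 \<le> (r + a - z)\<^sup>2 / c + r\<^sup>2 / v"
          using bivariate_rate [OF v w uv \<tau>, of a r] by (simp only: c_def)
        hence "(1 - \<epsilon>) * (- (r + a - z)\<^sup>2 / c) \<le> (1 - \<epsilon>) * (r\<^sup>2 / v - a\<^sup>2 / \<tau>\<^sup>2)"
          using \<epsilon> by (intro mult_left_mono) auto
        thus "- (1 - \<epsilon>) * (r + a - z)\<^sup>2 / c \<le> (1 - \<epsilon>) * (r\<^sup>2 / v - a\<^sup>2 / \<tau>\<^sup>2)"
          by (simp add: minus_divide_left [symmetric] del: minus_diff_eq)
      qed simp
      finally show ?thesis unfolding C .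
    next
      case False
      \<comment> \<open>The event is not rare given y, so the trivial bound 1 is used; then r is so large that
        the exponent on the right is nonnegative, by the rate inequality at the point R where the conditional cost vanishes.\<close>
      have "(\<integral>\<^sup>+x. poisson_gamma_pdf \<alpha> c (w / v\<^sup>2 * y / c) x * indicator ?A (x, y) \<partial>lborel)
          \<le> (\<integral>\<^sup>+x. poisson_gamma_pdf \<alpha> c (z\<^sup>2 / c) x * ennreal (exp (0 * x)) \<partial>lborel)"
        unfolding z(2) by (intro nn_integral_mono mult_left_mono) (auto simp: indicator_def)
      also have "\<dots> = ennreal 1"
        using z c by (subst poisson_gamma_pdf_mgf [OF \<alpha> c]) auto
      also have "\<dots> \<le> ennreal (\<epsilon> powr - \<alpha> * exp ((1 - \<epsilon>) * (r\<^sup>2 / v - a\<^sup>2 / \<tau>\<^sup>2)))"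
      proof (rule ennreal_leI)
        define R where "R = - a / (1 - sqrt w / v)"
        have d: "(1 - sqrt w / v) * r \<le> - a" using False by (simp add: z_def algebra_simps)
        hence d0: "1 - sqrt w / v < 0" using a r
          by (metis le_minus_iff mult_nonneg_nonneg neg_less_0_iff_less not_less order.strict_trans2 linorder_not_le)
        have "R \<le> r" using d d0 by (simp add: R_def field_simps)
        moreover have "0 \<le> R" using d0 a by (simp add: R_def field_simps divide_nonpos_neg)
        ultimately have "R\<^sup>2 \<le> r\<^sup>2" by (intro power_mono) auto
        moreover have "x * (- a / x) = - a" if "x < 0" for x :: real using that by simp
        from this [OF d0] have "a + (1 - sqrt w / v) * R = 0" unfolding R_def by linarith
        hence "a\<^sup>2 / \<tau>\<^sup>2 \<le> R\<^sup>2 / v"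
          using bivariate_rate [OF v w uv \<tau>, of a R] by simp
        ultimately have "a\<^sup>2 / \<tau>\<^sup>2 \<le> r\<^sup>2 / v" using v by (meson divide_right_mono less_imp_le order_trans)
        hence "1 \<le> exp ((1 - \<epsilon>) * (r\<^sup>2 / v - a\<^sup>2 / \<tau>\<^sup>2))" using \<epsilon> by simp
        moreover have "1 \<le> \<epsilon> powr - \<alpha>"
          using \<epsilon> \<alpha> powr_mono2' [of "- \<alpha>" \<epsilon> 1] by simp
        ultimately show "1 \<le> \<epsilon> powr - \<alpha> * exp ((1 - \<epsilon>) * (r\<^sup>2 / v - a\<^sup>2 / \<tau>\<^sup>2))"
          by (metis mult_mono' mult_1 zero_le_one)
      qed
      finally show ?thesis unfolding C .
    qed
  qed
  have "emeasure (bivariate_gamma \<alpha> u v w) ?A = (\<integral>\<^sup>+z. indicator ?A z \<partial>bivariate_gamma \<alpha> u v w)"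
    by (rule nn_integral_indicator [symmetric]) simp
  also have "\<dots> = (\<integral>\<^sup>+y. ennreal (gamma_pdf \<alpha> v y) * (\<integral>\<^sup>+x. poisson_gamma_pdf \<alpha> c (w / v\<^sup>2 * y / c) x
        * indicator ?A (x, y) \<partial>lborel) \<partial>lborel)"
    by (subst nn_integral_bivariate_gamma) (auto simp: c_def)
  also have "\<dots> \<le> (\<integral>\<^sup>+y. ?C * ennreal (gamma_pdf \<alpha> v y * exp ((1 - \<epsilon>) / v * y)) \<partial>lborel)"
  proof (rule nn_integral_mono)
    fix y :: real
    show "ennreal (gamma_pdf \<alpha> v y) * (\<integral>\<^sup>+x. poisson_gamma_pdf \<alpha> c (w / v\<^sup>2 * y / c) x
        * indicator ?A (x, y) \<partial>lborel) \<le> ?C * ennreal (gamma_pdf \<alpha> v y * exp ((1 - \<epsilon>) / v * y))"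
    proof (cases "0 \<le> y")
      case True
      from mult_left_mono [OF inner [OF True], of "ennreal (gamma_pdf \<alpha> v y)"]
      show ?thesis by (simp add: ennreal_mult'' mult_ac)
    qed (simp add: gamma_pdf_def)
  qed
  also have "\<dots> = ?C * ennreal (\<epsilon> powr - \<alpha>)"
  proof -
    have "(\<integral>\<^sup>+y. ennreal (gamma_pdf \<alpha> v y * exp ((1 - \<epsilon>) / v * y)) \<partial>lborel) = ennreal ((1 - v * ((1 - \<epsilon>) / v)) powr - \<alpha>)"
      by (rule gamma_pdf_mgf [OF \<alpha> v]) (use v \<epsilon> in simp)
    moreover have "1 - v * ((1 - \<epsilon>) / v) = \<epsilon>" using v by simp
    ultimately show ?thesis by (subst nn_integral_cmult) auto
  qed
  also have "\<dots> = ennreal (\<epsilon> powr (- 2 * \<alpha>) * exp (- (1 - \<epsilon>) * a\<^sup>2 / \<tau>\<^sup>2))"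
  proof -
    have "\<epsilon> powr (- 2 * \<alpha>) = \<epsilon> powr - \<alpha> * \<epsilon> powr - \<alpha>" by (simp add: powr_add [symmetric])
    thus ?thesis by (subst ennreal_mult [symmetric]) (auto simp: mult_ac)
  qed
  finally show ?thesis .
qed

section \<open>A continuity theorem for Laplace transforms\<close>

text \<open>Polynomials in two variables as functions. Under the substitution \<open>(exp (- x), exp (- y))\<close> a monomial
becomes \<open>exp (- i * x - j * y)\<close>, whose integral is a value of the Laplace transform.\<close>

inductive bipoly :: "(real \<times> real \<Rightarrow> real) \<Rightarrow> bool" where
  monomial: "bipoly (\<lambda>z. c * fst z ^ i * snd z ^ j)"
| add: "bipoly f \<Longrightarrow> bipoly g \<Longrightarrow> bipoly (\<lambda>z. f z + g z)"

lemma bipoly_mult_monomial: "bipoly f \<Longrightarrow> bipoly (\<lambda>z. (c * fst z ^ i * snd z ^ j) * f z)"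
proof (induction rule: bipoly.induct)
  case (monomial c' i' j')
  have "(\<lambda>z :: real \<times> real. (c * fst z ^ i * snd z ^ j) * (c' * fst z ^ i' * snd z ^ j'))
      = (\<lambda>z. (c * c') * fst z ^ (i + i') * snd z ^ (j + j'))"
    by (simp add: power_add mult_ac)
  thus ?case by (simp only: bipoly.monomial)
next
  case (add f g)
  from bipoly.add [OF add.IH] show ?case by (simp only: distrib_left)
qed

lemma bipoly_mult: "bipoly f \<Longrightarrow> bipoly g \<Longrightarrow> bipoly (\<lambda>z. f z * g z)"
proof (induction rule: bipoly.induct)
  case (monomial c i j)
  thus ?case by (rule bipoly_mult_monomial)
next
  case (add f f')
  from bipoly.add [OF add.IH(1) [OF add.prems] add.IH(2) [OF add.prems]]
  show ?case by (simp only: distrib_right)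
qed

lemma bipoly_continuous: "bipoly f \<Longrightarrow> continuous_on S f"
  by (induction rule: bipoly.induct) (auto intro!: continuous_intros)

lemma bipoly_dense:
  assumes "continuous_on ({0..1} \<times> {0..1}) H" and "0 < e"
  obtains g where "bipoly g" "\<And>z. z \<in> {0..1} \<times> {0..1} \<Longrightarrow> \<bar>H z - g z\<bar> < e"
proof -
  have "\<exists>g. bipoly g \<and> (\<forall>z \<in> {0..1} \<times> {0..1}. \<bar>H z - g z\<bar> < e)"
  proof (rule Stone_Weierstrass_HOL [where P = bipoly])
    show "bipoly (\<lambda>z. c)" for c using bipoly.monomial [of c 0 0] by simp
    have 1: "bipoly fst" using bipoly.monomial [of 1 1 0] by simp 
    have 2: "bipoly snd" using bipoly.monomial [of 1 0 1] by simp
    show "\<exists>f. bipoly f \<and> f x \<noteq> f y" if "x \<in> {0..1} \<times> {0..1} \<and> y \<in> {0..1} \<times> {0..1} \<and> x \<noteq> y" for x y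
      using 1 2 that by (cases x; cases y) auto
  qed (use assms in \<open>auto intro: compact_Times bipoly.add bipoly_mult bipoly_continuous\<close>)
  thus ?thesis using that by auto
qed

text \<open>A continuity theorem for bivariate Laplace transforms, tested on continuous functions that
vanish for large arguments. Such a function equals \<open>exp (- x - y) * H (exp (- x), exp (- y))\<close> on the
quadrant with \<open>H\<close> continuous on the unit square, and \<open>H\<close> is a uniform limit of polynomials by
Stone-Weierstrass. The extra factor \<open>exp (- x - y)\<close> keeps all Laplace arguments strictly positive.\<close>

lemma exp_integral_tendsto:
  fixes F :: "real \<times> real \<Rightarrow> real" and P :: "(real \<times> real) measure" and Q :: "nat \<Rightarrow> (real \<times> real) measure"
  assumes P: "prob_space P" "sets P = sets borel" "AE z in P. 0 \<le> fst z \<and> 0 \<le> snd z"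
    and Q: "\<And>n. prob_space (Q n)" "\<And>n. sets (Q n) = sets borel" "\<And>n. AE z in Q n. 0 \<le> fst z \<and> 0 \<le> snd z"
    and lim: "\<And>s t. 0 < s \<Longrightarrow> 0 < t \<Longrightarrow>
       (\<lambda>n. \<integral>z. exp (- (s * fst z + t * snd z)) \<partial>Q n) \<longlonglongrightarrow> (\<integral>z. exp (- (s * fst z + t * snd z)) \<partial>P)"
    and F: "continuous_on UNIV F" and R: "\<And>x y. R \<le> x \<or> R \<le> y \<Longrightarrow> F (x, y) = 0"
  shows "(\<lambda>n. \<integral>z. F z \<partial>Q n) \<longlonglongrightarrow> (\<integral>z. F z \<partial>P)"
proof -
  define good where "good = (\<lambda>P :: (real \<times> real) measure. prob_space P \<and> sets P = sets borel \<and> (AE z in P. 0 \<le> fst z \<and> 0 \<le> snd z))"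
  have gP: "good P" and gQ: "good (Q n)" for n using P Q by (auto simp: good_def)
  define E where "E = (\<lambda>g z. exp (- fst z - snd z) * g (exp (- fst z), exp (- snd z)) :: real)"
  \<comment> \<open>The cut-off of p and q at exp (- R) avoids the singularities at 0; where it is active, F vanishes.\<close>
  define H where "H = (\<lambda>(p, q). F (- ln (max p (exp (- R))), - ln (max q (exp (- R)))) / (max p (exp (- R)) * max q (exp (- R))))"
  have mx: "0 < max p (exp (- R))" for p :: real by (simp add: less_max_iff_disj)
  have Hcont: "continuous_on S H" for S
    unfolding H_def case_prod_beta
    by (intro continuous_intros continuous_on_compose2 [OF F]) (use mx in \<open>auto simp: less_imp_neq [symmetric]\<close>)
  have EH: "E H (x, y) = F (x, y)" if "0 \<le> x" "0 \<le> y" for x y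
  proof (cases "R \<le> x \<or> R \<le> y")
    case True
    have "F (- ln (max (exp (- x)) (exp (- R))), - ln (max (exp (- y)) (exp (- R)))) = 0"
      by (rule R) (use True in \<open>auto simp: max_def\<close>)
    thus ?thesis using R [OF True] by (simp add: E_def H_def)
  next
    case False
    hence "max (exp (- x)) (exp (- R)) = exp (- x)" "max (exp (- y)) (exp (- R)) = exp (- y)" by auto
    thus ?thesis by (simp add: E_def H_def mult_exp_exp)
  qed
  have int: "integrable P (E g)" if "good P" "continuous_on UNIV g" for P g
  proof -
    interpret prob_space P using that by (simp add: good_def)
    have "continuous_on ({0..1} \<times> {0..1}) g" using that(2) continuous_on_subset by blast
    hence "bounded (g ` ({0..1} \<times> {0..1}))"
      by (intro compact_imp_bounded compact_continuous_image compact_Times) auto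
    then obtain B where B: "\<And>z. z \<in> {0..1} \<times> {0..1} \<Longrightarrow> \<bar>g z\<bar> \<le> B" unfolding bounded_iff by auto
    show ?thesis
    proof (rule integrable_const_bound)
      have "AE z in P. 0 \<le> fst z \<and> 0 \<le> snd z" using that by (simp add: good_def)
      thus "AE z in P. norm (E g z) \<le> B"
      proof eventually_elim
        case (elim z)
        have "\<bar>g (exp (- fst z), exp (- snd z))\<bar> \<le> B" using elim by (intro B) auto
        moreover have "exp (- fst z - snd z) \<le> 1" using elim by auto
        ultimately have "exp (- fst z - snd z) * \<bar>g (exp (- fst z), exp (- snd z))\<bar> \<le> 1 * B"
          by (intro mult_mono) auto
        thus ?case by (simp add: E_def abs_mult)
      qed
      have "continuous_on UNIV (E g)"
        unfolding E_def by (intro continuous_intros continuous_on_compose2 [OF that(2)]) auto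
      thus "E g \<in> borel_measurable P" using that(1) unfolding good_def
        by (metis borel_measurable_continuous_onI measurable_cong_sets)
    qed
  qed
  have EF: "(\<integral>z. E H z \<partial>P) = (\<integral>z. F z \<partial>P)" if "good P" for P
  proof (rule integral_cong_AE)
    have "AE z in P. 0 \<le> fst z \<and> 0 \<le> snd z" using that by (simp add: good_def)
    thus "AE z in P. E H z = F z" by eventually_elim (metis EH prod.collapse)
    show "E H \<in> borel_measurable P" using int [OF that Hcont] by simp
    show "F \<in> borel_measurable P" using that F unfolding good_def
      by (metis borel_measurable_continuous_onI measurable_cong_sets)
  qed
  have conv: "(\<lambda>n. \<integral>z. E g z \<partial>Q n) \<longlonglongrightarrow> (\<integral>z. E g z \<partial>P)" if "bipoly g" for g
    using that
  proof (induction rule: bipoly.induct)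
    case (monomial c i j)
    have "E (\<lambda>z. c * fst z ^ i * snd z ^ j) = (\<lambda>z. c * exp (- (real (Suc i) * fst z + real (Suc j) * snd z)))"
      by (auto simp: E_def fun_eq_iff exp_of_nat_mult [symmetric] mult_exp_exp algebra_simps)
    thus ?case unfolding integral_mult_right_zero
      by (simp only: integral_mult_right_zero) (intro tendsto_mult tendsto_const lim, simp_all del: of_nat_Suc)
  next
    case (add f g)
    have c: "continuous_on UNIV f" "continuous_on UNIV g" using add.hyps bipoly_continuous by auto
    have "E (\<lambda>z. f z + g z) = (\<lambda>z. E f z + E g z)" by (auto simp: E_def distrib_left)
    thus ?case using int [OF gP c(1)] int [OF gP c(2)] int [OF gQ c(1)] int [OF gQ c(2)] add.IH
      by (auto intro!: tendsto_intros)
  qed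
  show ?thesis
  proof (rule LIMSEQ_I)
    fix e :: real assume e: "0 < e"
    obtain g where g: "bipoly g" "\<And>z. z \<in> {0..1} \<times> {0..1} \<Longrightarrow> \<bar>H z - g z\<bar> < e / 3"
      using bipoly_dense [OF Hcont, of "e / 3"] e by auto
    have gc: "continuous_on UNIV g" using g bipoly_continuous by auto
    have near: "\<bar>(\<integral>z. F z \<partial>P) - (\<integral>z. E g z \<partial>P)\<bar> \<le> e / 3" if gP: "good P" for P
    proof -
      interpret prob_space P using that by (simp add: good_def)
      have "(\<integral>z. F z \<partial>P) - (\<integral>z. E g z \<partial>P) = (\<integral>z. E H z - E g z \<partial>P)"
        using int [OF gP Hcont] int [OF gP gc] EF [OF gP] by simp
      also have "\<bar>\<dots>\<bar> \<le> (\<integral>z. \<bar>E H z - E g z\<bar> \<partial>P)" by simp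
      also have "\<dots> \<le> (\<integral>z. e / 3 \<partial>P)"
      proof (rule integral_mono_AE)
        have "AE z in P. 0 \<le> fst z \<and> 0 \<le> snd z" using that by (simp add: good_def)
        thus "AE z in P. \<bar>E H z - E g z\<bar> \<le> e / 3"
        proof eventually_elim
          case (elim z)
          have "\<bar>H (exp (- fst z), exp (- snd z)) - g (exp (- fst z), exp (- snd z))\<bar> \<le> e / 3"
            using elim by (intro less_imp_le g) auto
          moreover have "exp (- fst z - snd z) \<le> 1" using elim by auto
          ultimately have "exp (- fst z - snd z) * \<bar>H (exp (- fst z), exp (- snd z)) - g (exp (- fst z), exp (- snd z))\<bar> \<le> 1 * (e / 3)"
            by (intro mult_mono) auto
          thus ?case by (simp add: E_def right_diff_distrib [symmetric] abs_mult)
        qed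
      qed (use int [OF gP Hcont] int [OF gP gc] in auto)
      also have "\<dots> = e / 3" by (simp add: prob_space)
      finally show ?thesis .
    qed
    have "\<forall>\<^sub>F n in sequentially. \<bar>(\<integral>z. E g z \<partial>Q n) - (\<integral>z. E g z \<partial>P)\<bar> < e / 3"
      using tendstoD [OF conv [OF g(1)], of "e / 3"] e by (simp add: dist_real_def)
    then obtain n0 where n0: "\<And>n. n0 \<le> n \<Longrightarrow> \<bar>(\<integral>z. E g z \<partial>Q n) - (\<integral>z. E g z \<partial>P)\<bar> < e / 3"
      by (auto simp: eventually_sequentially)
    have "norm ((\<integral>z. F z \<partial>Q n) - (\<integral>z. F z \<partial>P)) < e" if "n0 \<le> n" for n
      using near [OF gP] near [OF gQ, of n] n0 [OF that] unfolding real_norm_def by linarith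
    thus "\<exists>n0. \<forall>n\<ge>n0. norm ((\<integral>z. F z \<partial>Q n) - (\<integral>z. F z \<partial>P)) < e" by blast
  qed
qed

section \<open>Tail bounds for increments of the square root\<close>

lemma bivariate_gamma_prob_space:
  assumes "0 < \<alpha>" "0 < v" "0 \<le> w" "w < u * v"
  shows "prob_space (bivariate_gamma \<alpha> u v w)"
proof
  have "emeasure (bivariate_gamma \<alpha> u v w) (space (bivariate_gamma \<alpha> u v w)) = (\<integral>\<^sup>+z. ennreal (exp (- (0 * fst z + 0 * snd z))) \<partial>bivariate_gamma \<alpha> u v w)"
    by simp
  also have "\<dots> = 1" using assms by (subst bivariate_gamma_laplace) auto
  finally show "emeasure (bivariate_gamma \<alpha> u v w) (space (bivariate_gamma \<alpha> u v w)) = 1" .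
qed

lemma bivariate_gamma_AE_nonneg: "AE z in bivariate_gamma \<alpha> u v w. 0 \<le> fst z \<and> 0 \<le> snd z"
proof -
  let ?f = "\<lambda>(x, y). ennreal (gamma_pdf \<alpha> v y) * poisson_gamma_pdf \<alpha> ((u * v - w) / v) (w / v\<^sup>2 * y / ((u * v - w) / v)) x"
  have "?f \<in> borel_measurable (lborel \<Otimes>\<^sub>M lborel)" by measurable
  moreover have "0 \<le> x \<and> 0 \<le> y" if "0 < ?f (x, y)" for x y
  proof (rule ccontr)
    assume "\<not> (0 \<le> x \<and> 0 \<le> y)"
    hence "?f (x, y) = 0" by (auto simp: poisson_gamma_pdf_neg gamma_pdf_def)
    thus False using that by (simp only: less_irrefl)
  qed
  ultimately show ?thesis unfolding bivariate_gamma_def by (subst AE_density) auto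
qed

text \<open>The tail bound for a pair with a permanental Laplace transform, degenerate or not. The explicit
law is only available for \<open>0 < v\<close> and \<open>w < u * v\<close>, so \<open>\<delta>\<close> is added to both diagonal entries, which raises
the squared sigma function by \<open>2 * \<delta>\<close>; the continuity theorem transports the bound along \<open>\<delta> \<rightarrow> 0\<close>, first
for continuous functions below the indicator of the event, then for the event itself. The bound depends on
the kernel only through \<open>\<tau>\<close>.\<close>

lemma permanental_pair_tail:
  fixes X Y :: "'w \<Rightarrow> real"
  assumes M: "prob_space M" and XY [measurable]: "X \<in> borel_measurable M" "Y \<in> borel_measurable M"
    and nn: "AE \<omega> in M. 0 \<le> X \<omega>" "AE \<omega> in M. 0 \<le> Y \<omega>"
    and \<alpha>: "0 < \<alpha>" and uvw: "0 \<le> u" "0 \<le> v" "0 \<le> w" "w \<le> u * v"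
    and laplace: "\<And>s t. 0 < s \<Longrightarrow> 0 < t \<Longrightarrow>
       (\<integral>\<omega>. exp (- (s * X \<omega> + t * Y \<omega>)) \<partial>M) = (1 + u * s + v * t + (u * v - w) * s * t) powr - \<alpha>"
    and \<tau>: "0 < \<tau>" "u + v - 2 * sqrt w \<le> \<tau>\<^sup>2" and a: "0 < a" and \<epsilon>: "0 < \<epsilon>" "\<epsilon> < 1"
  shows "measure M {\<omega> \<in> space M. sqrt (Y \<omega>) + a < sqrt (X \<omega>)} \<le> \<epsilon> powr (- 2 * \<alpha>) * exp (- (1 - \<epsilon>) * a\<^sup>2 / \<tau>\<^sup>2)"
proof -
  interpret prob_space M by (rule M)
  define \<delta> where "\<delta> = (\<lambda>n. inverse (real (Suc n)))"
  have \<delta>0: "0 < \<delta> n" for n by (simp add: \<delta>_def)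
  have \<delta>lim: "\<delta> \<longlonglongrightarrow> 0" unfolding \<delta>_def by (rule LIMSEQ_inverse_real_of_nat)
  have uv: "w < (u + \<delta> n) * (v + \<delta> n)" for n
  proof -
    have "0 < \<delta> n * \<delta> n" using \<delta>0 by simp
    moreover have "0 \<le> \<delta> n * (u + v)" using \<delta>0 [of n] uvw by simp
    ultimately show ?thesis using uvw by (simp add: algebra_simps)
  qed
  have v: "0 < v + \<delta> n" for n using \<delta>0 [of n] uvw by simp
  define Q where "Q = (\<lambda>n. bivariate_gamma \<alpha> (u + \<delta> n) (v + \<delta> n) w)"
  define P where "P = distr M borel (\<lambda>\<omega>. (X \<omega>, Y \<omega>))"
  have Qp: "prob_space (Q n)" for n
    unfolding Q_def by (rule bivariate_gamma_prob_space [OF \<alpha> v uvw(3) uv])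
  have Qs [measurable_cong, simp]: "sets (Q n) = sets borel" for n unfolding Q_def sets_bivariate_gamma by (subst borel_prod) (rule refl)
  have Qsp [simp]: "space (Q n) = UNIV" for n unfolding Q_def by simp
  have Pp: "prob_space P" unfolding P_def by (rule prob_space_distr) measurable
  \<comment> \<open>These functions increase to the indicator of the event as k grows.\<close>
  define F where "F = (\<lambda>k z. max 0 (min 1 (real k * (sqrt (fst z) - sqrt (snd z) - a))) *
      (max 0 (min 1 (real k - fst z)) * max 0 (min 1 (real k - snd z))))"
  have Fc: "continuous_on UNIV (F k)" for k unfolding F_def by (intro continuous_intros)
  have F01: "0 \<le> F k z" "F k z \<le> 1" for k z
    unfolding F_def by (auto intro!: mult_le_one)
  define b where "b = \<epsilon> powr (- 2 * \<alpha>) * exp (- (1 - \<epsilon>) * a\<^sup>2 / \<tau>\<^sup>2)"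
  have lim: "(\<lambda>n. \<integral>z. F k z \<partial>Q n) \<longlonglongrightarrow> (\<integral>z. F k z \<partial>P)" for k
  proof (rule exp_integral_tendsto [where R = "real k"])
    show "sets P = sets borel" by (simp add: P_def)
    show "AE z in P. 0 \<le> fst z \<and> 0 \<le> snd z" 
    proof -
      have "closed {z :: real \<times> real. 0 \<le> fst z \<and> 0 \<le> snd z}"
        by (intro closed_Collect_conj closed_Collect_le continuous_intros)
      thus ?thesis unfolding P_def using nn by (subst AE_distr_iff) (auto intro: borel_closed)
    qed
    show "AE z in Q n. 0 \<le> fst z \<and> 0 \<le> snd z" for n unfolding Q_def by (rule bivariate_gamma_AE_nonneg)
    show "F k (x, y) = 0" if "real k \<le> x \<or> real k \<le> y" for x y
      using that by (auto simp: F_def)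
    fix s t :: real assume st: "0 < s" "0 < t"
    have 1: "(\<integral>z. exp (- (s * fst z + t * snd z)) \<partial>Q n)
        = (1 + (u + \<delta> n) * s + (v + \<delta> n) * t + ((u + \<delta> n) * (v + \<delta> n) - w) * s * t) powr - \<alpha>" for n
    proof -
      have "(\<integral>z. exp (- (s * fst z + t * snd z)) \<partial>Q n) = enn2real (\<integral>\<^sup>+z. ennreal (exp (- (s * fst z + t * snd z))) \<partial>Q n)"
      proof (rule integral_eq_nn_integral)
        show "(\<lambda>z. exp (- (s * fst z + t * snd z))) \<in> borel_measurable (Q n)"
          by (subst measurable_cong_sets [OF Qs refl]) (intro borel_measurable_continuous_onI continuous_intros)
      qed auto
      thus ?thesis unfolding Q_def using st
        by (subst (asm) bivariate_gamma_laplace [OF \<alpha> v uvw(3) uv]) auto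
    qed
    have 2: "(\<integral>z. exp (- (s * fst z + t * snd z)) \<partial>P) = (1 + u * s + v * t + (u * v - w) * s * t) powr - \<alpha>"
    proof -
      have "(\<lambda>z :: real \<times> real. exp (- (s * fst z + t * snd z))) \<in> borel_measurable borel"
        by (intro borel_measurable_continuous_onI continuous_intros)
      moreover have "(\<lambda>\<omega>. (X \<omega>, Y \<omega>)) \<in> M \<rightarrow>\<^sub>M borel" by measurable
      ultimately show ?thesis
        unfolding P_def by (simp only: integral_distr fst_conv snd_conv laplace [OF st])
    qed
    have "0 \<le> u * s" "0 \<le> v * t" "0 \<le> (u * v - w) * s * t" using uvw st by auto
    hence 3: "1 + u * s + v * t + (u * v - w) * s * t \<noteq> 0" by linarith
    have "(\<lambda>n. (1 + (u + \<delta> n) * s + (v + \<delta> n) * t + ((u + \<delta> n) * (v + \<delta> n) - w) * s * t) powr - \<alpha>)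
       \<longlonglongrightarrow> (1 + (u + 0) * s + (v + 0) * t + ((u + 0) * (v + 0) - w) * s * t) powr - \<alpha>"
      using 3 by (intro tendsto_intros \<delta>lim) auto
    thus "(\<lambda>n. \<integral>z. exp (- (s * fst z + t * snd z)) \<partial>Q n) \<longlonglongrightarrow> (\<integral>z. exp (- (s * fst z + t * snd z)) \<partial>P)"
      unfolding 1 2 by simp
  qed (use Pp Qp Fc in auto)
  have Fm [measurable]: "F k \<in> borel_measurable borel" for k
    using Fc by (rule borel_measurable_continuous_onI)
  have FQ: "(\<integral>z. F k z \<partial>Q n) \<le> \<epsilon> powr (- 2 * \<alpha>) * exp (- (1 - \<epsilon>) * a\<^sup>2 / (\<tau>\<^sup>2 + 2 * \<delta> n))" for k n
  proof -
    interpret Q: prob_space "Q n" by (rule Qp)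
    define A where "A = {z :: real \<times> real. sqrt (snd z) + a \<le> sqrt (fst z)}"
    have "closed A" unfolding A_def by (intro closed_Collect_le continuous_intros)
    hence A [measurable]: "A \<in> sets borel" by (rule borel_closed)
    have "(\<integral>z. F k z \<partial>Q n) \<le> (\<integral>z. indicator A z \<partial>Q n)"
    proof (rule integral_mono)
      show "integrable (Q n) (F k)"
        by (rule Q.integrable_const_bound [where B = 1]) (use F01 in auto)
      show "integrable (Q n) (indicator A :: _ \<Rightarrow> real)"
        by (rule Q.integrable_const_bound [where B = 1]) auto
      show "F k z \<le> indicator A z" for z
      proof (cases "z \<in> A")
        case True thus ?thesis using F01 by simp
      next
        case False
        hence "real k * (sqrt (fst z) - sqrt (snd z) - a) \<le> 0"
          by (intro mult_nonneg_nonpos) (auto simp: A_def)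
        thus ?thesis using False by (simp add: F_def max_def)
      qed
    qed
    also have "\<dots> = measure (Q n) A" by simp
    also have "\<dots> \<le> \<epsilon> powr (- 2 * \<alpha>) * exp (- (1 - \<epsilon>) * a\<^sup>2 / (sqrt (\<tau>\<^sup>2 + 2 * \<delta> n))\<^sup>2)"
    proof -
      have p: "0 < \<tau>\<^sup>2 + 2 * \<delta> n" using \<tau> \<delta>0 [of n] by (simp add: add_pos_pos)
      have "emeasure (Q n) A \<le> ennreal (\<epsilon> powr (- 2 * \<alpha>) * exp (- (1 - \<epsilon>) * a\<^sup>2 / (sqrt (\<tau>\<^sup>2 + 2 * \<delta> n))\<^sup>2))"
        unfolding Q_def A_def using p \<tau>
        by (intro bivariate_gamma_tail [OF \<alpha> v uvw(3) uv _ _ a \<epsilon>]) auto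
      thus ?thesis by (simp add: Q.emeasure_eq_measure)
    qed
    also have "(sqrt (\<tau>\<^sup>2 + 2 * \<delta> n))\<^sup>2 = \<tau>\<^sup>2 + 2 * \<delta> n" using \<delta>0 [of n] by simp
    finally show ?thesis .
  qed
  have "(\<lambda>n. \<epsilon> powr (- 2 * \<alpha>) * exp (- (1 - \<epsilon>) * a\<^sup>2 / (\<tau>\<^sup>2 + 2 * \<delta> n))) \<longlonglongrightarrow>
      \<epsilon> powr (- 2 * \<alpha>) * exp (- (1 - \<epsilon>) * a\<^sup>2 / (\<tau>\<^sup>2 + 2 * 0))"
    using \<tau> by (intro tendsto_intros \<delta>lim) auto
  hence FP: "(\<integral>z. F k z \<partial>P) \<le> b" for k
    using LIMSEQ_le [OF lim] FQ by (auto simp: b_def)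
  have "(\<lambda>k. \<integral>\<omega>. F k (X \<omega>, Y \<omega>) \<partial>M) \<longlonglongrightarrow> (\<integral>\<omega>. indicator {\<omega> \<in> space M. sqrt (Y \<omega>) + a < sqrt (X \<omega>)} \<omega> \<partial>M)"
  proof (rule integral_dominated_convergence [where w = "\<lambda>_. 1"])
    show "AE \<omega> in M. (\<lambda>k. F k (X \<omega>, Y \<omega>)) \<longlonglongrightarrow> indicator {\<omega> \<in> space M. sqrt (Y \<omega>) + a < sqrt (X \<omega>)} \<omega>"
    proof (rule AE_I2)
      fix \<omega> assume \<omega>: "\<omega> \<in> space M"
      define g where "g = sqrt (X \<omega>) - sqrt (Y \<omega>) - a"
      have big: "\<forall>\<^sub>F k in sequentially. c \<le> real k" for c
        by (rule eventually_mono [OF eventually_ge_at_top [of "nat \<lceil>c\<rceil>"]]) linarith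
      show "(\<lambda>k. F k (X \<omega>, Y \<omega>)) \<longlonglongrightarrow> indicator {\<omega> \<in> space M. sqrt (Y \<omega>) + a < sqrt (X \<omega>)} \<omega>"
      proof (cases "0 < g")
        case True
        have "\<forall>\<^sub>F k in sequentially. F k (X \<omega>, Y \<omega>) = 1"
          using big [of "1 / g"] big [of "X \<omega> + 1"] big [of "Y \<omega> + 1"]
        proof eventually_elim
          case (elim k)
          hence "1 \<le> real k * g" using True by (simp add: field_simps)
          thus ?case using elim by (simp add: F_def g_def)
        qed
        thus ?thesis using True \<omega> by (intro tendsto_eventually) (auto simp: g_def)
      next
        case False
        have "F k (X \<omega>, Y \<omega>) = 0" for k
        proof -
          have "real k * g \<le> 0" using False by (intro mult_nonneg_nonpos) auto
          thus ?thesis by (simp add: F_def g_def)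
        qed
        thus ?thesis using False by (simp add: g_def)
      qed
    qed
  qed (use F01 in auto)
  moreover have "(\<integral>\<omega>. F k (X \<omega>, Y \<omega>) \<partial>M) = (\<integral>z. F k z \<partial>P)" for k
    unfolding P_def by (subst integral_distr) auto
  ultimately have "(\<integral>\<omega>. indicator {\<omega> \<in> space M. sqrt (Y \<omega>) + a < sqrt (X \<omega>)} \<omega> \<partial>M) \<le> b"
    using FP by (intro LIMSEQ_le_const2) auto
  thus ?thesis unfolding b_def by simp
qed

section \<open>Two-point marginals of a permanental process\<close>

lemma det_2x2:
  fixes A :: "real mat"
  assumes "A \<in> carrier_mat 2 2"
  shows "Determinant.det A = A $$ (0,0) * A $$ (1,1) - A $$ (0,1) * A $$ (1,0)"
proof -
  have "Determinant.det A = (\<Sum>j<2. A $$ (0,j) * cofactor A 0 j)"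
    by (rule laplace_expansion_row) (use assms in auto)
  also have "\<dots> = A $$ (0,0) * cofactor A 0 0 + A $$ (0,1) * cofactor A 0 1"
    by (simp add: numeral_2_eq_2)
  also have "cofactor A 0 0 = A $$ (1,1)"
    using assms by (simp add: cofactor_def det_single mat_delete_def)
  also have "cofactor A 0 1 = - A $$ (1,0)"
    using assms by (simp add: cofactor_def det_single mat_delete_def)
  finally show ?thesis by simp
qed

lemma permanental_process_pair:
  assumes P: "permanental_process M \<alpha> T X u" and ab: "a \<in> T" "b \<in> T" and s: "0 < s" "0 < t"
  shows "0 < 1 + u a a * s + u b b * t + (u a a * u b b - u a b * u b a) * s * t"
    and "(\<integral>\<omega>. exp (- (s * X a \<omega> + t * X b \<omega>)) \<partial>M)
       = (1 + u a a * s + u b b * t + (u a a * u b b - u a b * u b a) * s * t) powr - \<alpha>"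
proof -
  define p where "p = (\<lambda>i :: nat. if i = 0 then a else b)"
  define S where "S = (\<lambda>i :: nat. if i = 0 then s else t)"
  define U where "U = Matrix.mat 2 2 (\<lambda>(i, j). u (p i) (p j))"
  have "permanental_vector M \<alpha> 2 (\<lambda>i. X (p i)) U"
    using P ab unfolding permanental_process_def U_def p_def by auto
  hence *: "0 < Determinant.det (1\<^sub>m 2 + U * mat_diag 2 S) \<and>
     (\<integral>\<omega>. exp (- (\<Sum>i<2. S i * X (p i) \<omega>)) \<partial>M) = Determinant.det (1\<^sub>m 2 + U * mat_diag 2 S) powr (- \<alpha>)"
    unfolding permanental_vector_def using s by (auto simp: S_def)
  have "U * mat_diag 2 S = Matrix.mat 2 2 (\<lambda>(i, j). U $$ (i, j) * S j)"
    by (rule mat_diag_mult_right) (simp add: U_def)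
  hence "Determinant.det (1\<^sub>m 2 + U * mat_diag 2 S) = (1 + u a a * s) * (1 + u b b * t) - u a b * t * (u b a * s)"
    by (simp, subst det_2x2) (auto simp: U_def p_def S_def)
  also have "\<dots> = 1 + u a a * s + u b b * t + (u a a * u b b - u a b * u b a) * s * t"
    by (simp add: algebra_simps)
  finally have d: "Determinant.det (1\<^sub>m 2 + U * mat_diag 2 S) = \<dots>" .
  show "0 < 1 + u a a * s + u b b * t + (u a a * u b b - u a b * u b a) * s * t"
    using * unfolding d by simp
  have "(\<Sum>i<2. S i * X (p i) \<omega>) = s * X a \<omega> + t * X b \<omega>" for \<omega>
    by (simp add: numeral_2_eq_2 S_def p_def)
  thus "(\<integral>\<omega>. exp (- (s * X a \<omega> + t * X b \<omega>)) \<partial>M)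
       = (1 + u a a * s + u b b * t + (u a a * u b b - u a b * u b a) * s * t) powr - \<alpha>"
    using * unfolding d by simp
qed

lemma permanental_process_single:
  assumes P: "permanental_process M \<alpha> T X u" and a: "a \<in> T"
  shows "X a \<in> borel_measurable M" and "AE \<omega> in M. 0 \<le> X a \<omega>"
    and "0 < s \<Longrightarrow> 0 < 1 + u a a * s"
    and "0 < s \<Longrightarrow> (\<integral>\<omega>. exp (- (s * X a \<omega>)) \<partial>M) = (1 + u a a * s) powr - \<alpha>"
proof -
  define U where "U = Matrix.mat 1 1 (\<lambda>(i, j). u a a)"
  have "permanental_vector M \<alpha> 1 (\<lambda>i. X a) U"
    using P a unfolding permanental_process_def U_def by (auto dest: spec [of _ "1::nat"] spec [of _ "\<lambda>_. a"])
  hence *: "X a \<in> borel_measurable M \<and> (AE \<omega> in M. 0 \<le> X a \<omega>)"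
    "\<And>s. 0 < s \<Longrightarrow> 0 < Determinant.det (1\<^sub>m 1 + U * mat_diag 1 (\<lambda>_. s)) \<and>
     (\<integral>\<omega>. exp (- (s * X a \<omega>)) \<partial>M) = Determinant.det (1\<^sub>m 1 + U * mat_diag 1 (\<lambda>_. s)) powr (- \<alpha>)"
    unfolding permanental_vector_def by (auto dest: spec [of _ "\<lambda>_. _"])
  show "X a \<in> borel_measurable M" "AE \<omega> in M. 0 \<le> X a \<omega>" using * by auto
  have d: "Determinant.det (1\<^sub>m 1 + U * mat_diag 1 (\<lambda>_. s)) = 1 + u a a * s" for s
  proof -
    have "U * mat_diag 1 (\<lambda>_. s) = Matrix.mat 1 1 (\<lambda>(i, j). U $$ (i, j) * s)"
      by (rule mat_diag_mult_right) (simp add: U_def)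
    thus ?thesis by (simp, subst det_single) (auto simp: U_def)
  qed
  show "0 < s \<Longrightarrow> 0 < 1 + u a a * s" 
    "0 < s \<Longrightarrow> (\<integral>\<omega>. exp (- (s * X a \<omega>)) \<partial>M) = (1 + u a a * s) powr - \<alpha>"
    using *(2) [of s] unfolding d by auto
qed

text \<open>A negative entry would make the determinant \<open>1 + u a a * s\<close> vanish at
\<open>s = - 1 / u a a\<close>.\<close>

lemma permanental_kernel_diag_nonneg:
  assumes P: "permanental_process M \<alpha> T X u" and a: "a \<in> T"
  shows "0 \<le> u a a"
proof (rule ccontr)
  assume "\<not> 0 \<le> u a a"
  hence neg: "u a a < 0" by simp
  hence "0 < 1 + u a a * (- 1 / u a a)"
    by (intro permanental_process_single(3) [OF P a] divide_neg_neg) auto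
  thus False using neg by simp
qed

text \<open>If the minor were \<open>- d\<close> with \<open>d > 0\<close>, the determinant at \<open>(s, s)\<close> would be the quadratic
\<open>1 + p * s - d * s\<^sup>2\<close> with \<open>p\<close> the trace of the kernel, which is negative for large \<open>s\<close>.\<close>

lemma permanental_kernel_minor_nonneg:
  assumes P: "permanental_process M \<alpha> T X u" and ab: "a \<in> T" "b \<in> T"
  shows "u a b * u b a \<le> u a a * u b b"
proof (rule ccontr)
  define d where "d = u a b * u b a - u a a * u b b"
  assume "\<not> u a b * u b a \<le> u a a * u b b"
  hence d: "0 < d" by (simp add: d_def)
  define p where "p = u a a + u b b"
  have p: "0 \<le> p" using permanental_kernel_diag_nonneg [OF P ab(1)] permanental_kernel_diag_nonneg [OF P ab(2)]
    by (simp add: p_def)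
  define s where "s = (1 + p) / d + 1"
  have s: "1 \<le> s" using d p by (simp add: s_def)
  have "0 < 1 + u a a * s + u b b * s + (u a a * u b b - u a b * u b a) * s * s"
    using s by (intro permanental_process_pair(1) [OF P ab]) auto
  also have "\<dots> = 1 + p * s - (d * s) * s" by (simp add: p_def d_def algebra_simps)
  also have "d * s = 1 + p + d" using d by (simp add: s_def field_simps)
  finally have "(1 + d) * s < 1" by (simp add: algebra_simps)
  moreover have "1 * 1 \<le> (1 + d) * s" using d s by (intro mult_mono) auto
  ultimately show False by simp
qed

text \<open>If \<open>w = u s t * u t s\<close> is nonnegative, this is the bound for pairs. Should \<open>w\<close> be negative, then
\<open>sqrt w = - sqrt \<bar>w\<bar>\<close> in HOL, so the square of the sigma function is at least \<open>u s s\<close>, and the bound for the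
single variable \<open>X s\<close>, that is for the pair \<open>(X s, 0)\<close>, is enough.\<close>

lemma permanental_increment_one_sided:
  assumes M: "prob_space M" and \<alpha>: "0 < \<alpha>" and P: "permanental_process M \<alpha> T X u"
    and st: "s \<in> T" "t \<in> T" and \<tau>: "0 < \<tau>" "sigma_function u s t \<le> \<tau>"
    and a: "0 < a" and \<epsilon>: "0 < \<epsilon>" "\<epsilon> < 1"
  shows "measure M {\<omega> \<in> space M. sqrt (X t \<omega>) + a < sqrt (X s \<omega>)} \<le> \<epsilon> powr (- 2 * \<alpha>) * exp (- (1 - \<epsilon>) * a\<^sup>2 / \<tau>\<^sup>2)"
proof -
  interpret prob_space M by (rule M)
  define w where "w = u s t * u t s"
  have d: "0 \<le> u s s" "0 \<le> u t t" "w \<le> u s s * u t t"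
    using permanental_kernel_diag_nonneg [OF P] permanental_kernel_minor_nonneg [OF P] st by (auto simp: w_def)
  note m [measurable] = permanental_process_single(1) [OF P]
  have q: "u s s + u t t - 2 * sqrt w \<le> \<tau>\<^sup>2"
  proof (rule ccontr)
    assume "\<not> ?thesis"
    hence "sqrt (\<tau>\<^sup>2) < sqrt (u s s + u t t - 2 * sqrt w)" by (intro real_sqrt_less_mono) simp
    thus False using \<tau> by (simp add: sigma_function_def w_def)
  qed
  show ?thesis
  proof (cases "0 \<le> w")
    case True
    show ?thesis
      using permanental_process_pair(2) [OF P st] q d True st m permanental_process_single(2) [OF P]
      by (intro permanental_pair_tail [OF M _ _ _ _ \<alpha> _ _ _ _ _ \<tau>(1) _ a \<epsilon>, where u = "u s s" and v = "u t t" and w = w])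
         (auto simp: w_def)
  next
    case False
    have "measure M {\<omega> \<in> space M. sqrt (X t \<omega>) + a < sqrt (X s \<omega>)} \<le> measure M {\<omega> \<in> space M. sqrt 0 + a < sqrt (X s \<omega>)}"
    proof (rule finite_measure_mono_AE)
      show "AE \<omega> in M. \<omega> \<in> {\<omega> \<in> space M. sqrt (X t \<omega>) + a < sqrt (X s \<omega>)} \<longrightarrow> \<omega> \<in> {\<omega> \<in> space M. sqrt 0 + a < sqrt (X s \<omega>)}"
        using permanental_process_single(2) [OF P st(2)]
      proof eventually_elim
        case (elim \<omega>)
        have "sqrt 0 + a < sqrt (X s \<omega>)" if "sqrt (X t \<omega>) + a < sqrt (X s \<omega>)"
          using that real_sqrt_le_mono [OF elim] by linarith
        thus ?case by blast
      qed
      show "{\<omega> \<in> space M. sqrt 0 + a < sqrt (X s \<omega>)} \<in> sets M" using m [OF st(1)] by measurable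
    qed
    also have "\<dots> \<le> \<epsilon> powr (- 2 * \<alpha>) * exp (- (1 - \<epsilon>) * a\<^sup>2 / \<tau>\<^sup>2)"
    proof (rule permanental_pair_tail [OF M _ _ _ _ \<alpha> _ _ _ _ _ \<tau>(1) _ a \<epsilon>, where u = "u s s" and v = 0 and w = 0])
      have "sqrt w \<le> 0" using False by simp
      thus "u s s + 0 - 2 * sqrt 0 \<le> \<tau>\<^sup>2" unfolding real_sqrt_zero using q d by linarith
    qed (use d st m permanental_process_single(2,4) [OF P st(1)] in auto)
    finally show ?thesis .
  qed
qed

lemma permanental_increment_tail:
  assumes M: "prob_space M" and \<alpha>: "0 < \<alpha>" and P: "permanental_process M \<alpha> T X u"
    and st: "s \<in> T" "t \<in> T" and \<tau>: "0 < \<tau>" "sigma_function u s t \<le> \<tau>"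
    and a: "0 < a" and \<epsilon>: "0 < \<epsilon>" "\<epsilon> < 1"
  shows "measure M {\<omega> \<in> space M. a < \<bar>sqrt (X s \<omega>) - sqrt (X t \<omega>)\<bar>}
       \<le> 2 * \<epsilon> powr (- 2 * \<alpha>) * exp (- (1 - \<epsilon>) * a\<^sup>2 / \<tau>\<^sup>2)"
proof -
  interpret prob_space M by (rule M)
  note m = permanental_process_single(1) [OF P]
  have [measurable]: "X s \<in> borel_measurable M" "X t \<in> borel_measurable M" using m st by auto
  have sym: "sigma_function u t s \<le> \<tau>" using \<tau> by (simp add: sigma_function_def mult.commute add.commute)
  have "{\<omega> \<in> space M. a < \<bar>sqrt (X s \<omega>) - sqrt (X t \<omega>)\<bar>}
      = {\<omega> \<in> space M. sqrt (X t \<omega>) + a < sqrt (X s \<omega>)} \<union> {\<omega> \<in> space M. sqrt (X s \<omega>) + a < sqrt (X t \<omega>)}"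
    using a by auto
  also have "measure M \<dots> \<le> measure M {\<omega> \<in> space M. sqrt (X t \<omega>) + a < sqrt (X s \<omega>)}
      + measure M {\<omega> \<in> space M. sqrt (X s \<omega>) + a < sqrt (X t \<omega>)}"
    by (rule measure_Un_le) measurable
  also have "\<dots> \<le> 2 * \<epsilon> powr (- 2 * \<alpha>) * exp (- (1 - \<epsilon>) * a\<^sup>2 / \<tau>\<^sup>2)"
    using permanental_increment_one_sided [OF M \<alpha> P st \<tau> a \<epsilon>]
      permanental_increment_one_sided [OF M \<alpha> P st(2,1) \<tau>(1) sym a \<epsilon>] by simp
  finally show ?thesis .
qed

section \<open>Chaining along dyadic grids\<close>

definition dyadic_index :: "nat \<Rightarrow> real \<Rightarrow> nat" where "dyadic_index n s = nat \<lfloor>2 ^ n * s\<rfloor>"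

lemma dyadic_bounds:
  assumes "0 \<le> s"
  shows "real (dyadic_index n s) \<le> 2 ^ n * s" "2 ^ n * s < real (dyadic_index n s) + 1"
  using assms unfolding dyadic_index_def by (auto simp: of_nat_nat)

lemma dyadic_le:
  assumes "0 \<le> s" "s \<le> 1" shows "dyadic_index n s \<le> 2 ^ n"
proof -
  have "2 ^ n * s \<le> 2 ^ n * 1" using assms by (intro mult_left_mono) auto
  hence "real (dyadic_index n s) \<le> 2 ^ n" using dyadic_bounds(1) [OF assms(1), of n] by linarith
  hence "real (dyadic_index n s) \<le> real (2 ^ n)" by simp
  thus ?thesis by (simp only: of_nat_le_iff)
qed

lemma dyadic_point_unit:
  assumes "0 \<le> s" "s \<le> 1" shows "real (dyadic_index n s) / 2 ^ n \<in> {0..1}"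
proof -
  have "real (dyadic_index n s) \<le> real (2 ^ n)" using dyadic_le [OF assms, of n] by (simp only: of_nat_le_iff)
  thus ?thesis by simp
qed

lemma dyadic_Suc:
  assumes "0 \<le> s"
  shows "dyadic_index (Suc n) s = 2 * dyadic_index n s \<or> dyadic_index (Suc n) s = 2 * dyadic_index n s + 1"
proof -
  have "real (dyadic_index (Suc n) s) < real (2 * dyadic_index n s + 2)" "real (2 * dyadic_index n s) < real (dyadic_index (Suc n) s + 1)"
    using dyadic_bounds [OF assms, of n] dyadic_bounds [OF assms, of "Suc n"] by auto
  thus ?thesis unfolding of_nat_less_iff by linarith
qed

lemma dyadic_tendsto:
  assumes "0 \<le> s"
  shows "(\<lambda>n. real (dyadic_index n s) / 2 ^ n) \<longlonglongrightarrow> s"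
proof (rule real_tendsto_sandwich)
  have b: "s - 1 / 2 ^ n \<le> real (dyadic_index n s) / 2 ^ n" "real (dyadic_index n s) / 2 ^ n \<le> s" for n
    using divide_right_mono [OF less_imp_le [OF dyadic_bounds(2) [OF assms, of n]], of "2 ^ n"]
      divide_right_mono [OF dyadic_bounds(1) [OF assms, of n], of "2 ^ n"] by (auto simp: add_divide_distrib)
  show "\<forall>\<^sub>F n in sequentially. s - (1 / 2) ^ n \<le> real (dyadic_index n s) / 2 ^ n"
    "\<forall>\<^sub>F n in sequentially. real (dyadic_index n s) / 2 ^ n \<le> s"
    using b by (auto simp: power_divide)
  have "(\<lambda>n. s - (1 / 2 :: real) ^ n) \<longlonglongrightarrow> s - 0" by (intro tendsto_intros LIMSEQ_realpow_zero) auto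
  thus "(\<lambda>n. s - (1 / 2 :: real) ^ n) \<longlonglongrightarrow> s" by simp
qed auto

lemma dyadic_value_tendsto:
  fixes f :: "real \<Rightarrow> real"
  assumes "continuous_on {0..1} f" "0 \<le> s" "s \<le> 1"
  shows "(\<lambda>n. f (real (dyadic_index n s) / 2 ^ n)) \<longlonglongrightarrow> f s"
  by (rule continuous_on_tendsto_compose [OF assms(1) dyadic_tendsto [OF assms(2)]])
     (use assms dyadic_point_unit in auto)

text \<open>The constant of the chaining argument: \<open>r ^ j\<close> is the decay of \<open>\<phi>\<close> over \<open>j\<close> dyadic
generations, and \<open>sqrt (1 + j)\<close> bounds the growth of the square root of the logarithm.\<close>

lemma summable_geometric_sqrt:
  assumes "0 < r" "r < (1::real)"
  shows "summable (\<lambda>j. r ^ j * sqrt (1 + real j))"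
proof (rule summable_comparison_test)
  show "summable (\<lambda>j. real (Suc j) * r ^ j)"
    using geometric_deriv_sums [of r] assms by (auto simp: sums_iff)
  have "norm (r ^ j * sqrt (1 + real j)) \<le> real (Suc j) * r ^ j" for j
  proof -
    have "sqrt (1 + real j) \<le> 1 + real j" by (rule real_le_lsqrt) (auto simp: power2_eq_square)
    hence "r ^ j * sqrt (1 + real j) \<le> r ^ j * (1 + real j)" using assms by (intro mult_left_mono) auto
    thus ?thesis using assms by (simp add: abs_mult mult.commute)
  qed
  thus "\<exists>N. \<forall>j\<ge>N. norm (r ^ j * sqrt (1 + real j)) \<le> real (Suc j) * r ^ j" by blast
qed

text \<open>Telescoping along the dyadic approximations of \<open>s\<close>: two successive ones are equal or
neighbours in the finer grid, and the bounds for the increments decay geometrically.\<close>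

lemma dyadic_chaining:
  fixes f \<phi> :: "real \<Rightarrow> real"
  assumes f: "continuous_on {0..1} f" and e: "0 \<le> e" and n: "1 \<le> n"
    and r: "0 < r" "r < 1" and \<phi>: "\<And>j. \<phi> (1 / 2 ^ (n + j)) \<le> r ^ j * \<phi> (1 / 2 ^ n)" and \<phi>0: "\<And>j. 0 \<le> \<phi> (1 / 2 ^ (n + j))"
    and inc: "\<And>m i. n \<le> m \<Longrightarrow> Suc i \<le> 2 ^ m \<Longrightarrow>
      \<bar>f (real (Suc i) / 2 ^ m) - f (real i / 2 ^ m)\<bar> \<le> e * \<phi> (1 / 2 ^ m) * sqrt (real m * ln 2)"
    and s: "0 \<le> s" "s \<le> 1"
  shows "\<bar>f s - f (real (dyadic_index n s) / 2 ^ n)\<bar> \<le> e * \<phi> (1 / 2 ^ n) * sqrt (real n * ln 2) * (\<Sum>j. r ^ j * sqrt (1 + real j))"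
proof -
  define g where "g = (\<lambda>m. f (real (dyadic_index m s) / 2 ^ m))"
  define B where "B = e * \<phi> (1 / 2 ^ n) * sqrt (real n * ln 2)"
  have B: "0 \<le> B" unfolding B_def using e \<phi>0 [of 0] by simp
  define c where "c = (\<lambda>j. r ^ j * sqrt (1 + real j))"
  have c0: "0 \<le> c j" for j using r by (simp add: c_def)
  have step: "\<bar>g (n + Suc j) - g (n + j)\<bar> \<le> B * c (Suc j)" for j
  proof -
    define m where "m = n + Suc j"
    define i where "i = 2 * dyadic_index (n + j) s"
    have m: "m = Suc (n + j)" by (simp add: m_def)
    have gi: "g (n + j) = f (real i / 2 ^ m)" by (simp add: g_def i_def m)
    have gm: "g m = f (real (dyadic_index m s) / 2 ^ m)" by (simp add: g_def)
    have "dyadic_index m s = i \<or> dyadic_index m s = Suc i" using dyadic_Suc [OF s(1), of "n + j"] by (auto simp: m i_def)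
    hence "\<bar>g m - g (n + j)\<bar> \<le> e * \<phi> (1 / 2 ^ m) * sqrt (real m * ln 2)"
    proof
      assume "dyadic_index m s = i"
      thus ?thesis using e \<phi>0 [of "Suc j"] unfolding gm gi by (simp add: m_def)
    next
      assume d: "dyadic_index m s = Suc i"
      hence "Suc i \<le> 2 ^ m" using dyadic_le [OF s, of m] by simp
      thus ?thesis using inc [of m i] unfolding gm gi d by (simp add: m_def)
    qed
    also have "\<dots> \<le> e * (r ^ Suc j * \<phi> (1 / 2 ^ n)) * (sqrt (real n * ln 2) * sqrt (1 + real (Suc j)))"
    proof (intro mult_mono mult_left_mono)
      show "\<phi> (1 / 2 ^ m) \<le> r ^ Suc j * \<phi> (1 / 2 ^ n)" unfolding m_def by (rule \<phi>)
      have "real m \<le> real n * (1 + real (Suc j))"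
      proof -
        have "1 * Suc j \<le> n * Suc j" using n by (intro mult_right_mono) auto
        hence "m \<le> n * (1 + Suc j)" by (simp add: m_def)
        thus ?thesis by (metis of_nat_1 of_nat_add of_nat_le_iff of_nat_mult)
      qed
      hence "real m * ln 2 \<le> real n * (1 + real (Suc j)) * ln 2" by (rule mult_right_mono) auto
      hence "sqrt (real m * ln 2) \<le> sqrt (real n * (1 + real (Suc j)) * ln 2)" by (rule real_sqrt_le_mono)
      also have "\<dots> = sqrt (real n * ln 2) * sqrt (1 + real (Suc j))" by (simp add: real_sqrt_mult mult_ac)
      finally show "sqrt (real m * ln 2) \<le> sqrt (real n * ln 2) * sqrt (1 + real (Suc j))" .
    qed (use e r \<phi>0 [of 0] \<phi>0 [of "Suc j"] in \<open>auto simp: m_def\<close>)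
    also have "\<dots> = B * c (Suc j)" by (simp add: B_def c_def mult_ac)
    finally show ?thesis by (simp add: m_def)
  qed
  have partial: "\<bar>g (n + p) - g n\<bar> \<le> B * (\<Sum>j<p. c (Suc j))" for p
  proof (induction p)
    case (Suc p)
    have "\<bar>g (n + Suc p) - g n\<bar> \<le> \<bar>g (n + Suc p) - g (n + p)\<bar> + \<bar>g (n + p) - g n\<bar>" by linarith
    also have "\<dots> \<le> B * c (Suc p) + B * (\<Sum>j<p. c (Suc j))" by (intro add_mono step Suc.IH)
    finally show ?case by (simp add: distrib_left add.commute)
  qed simp
  have sm: "summable c" unfolding c_def by (rule summable_geometric_sqrt [OF r])
  have bound: "\<bar>g (n + p) - g n\<bar> \<le> B * suminf c" for p
  proof -
    have "(\<Sum>j<p. c (Suc j)) = (\<Sum>j<Suc p. c j) - c 0" by (subst sum.lessThan_Suc_shift) simp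
    also have "\<dots> \<le> suminf c"
    proof -
      have "(\<Sum>j<Suc p. c j) \<le> suminf c" by (intro sum_le_suminf sm) (use c0 in auto)
      thus ?thesis using c0 [of 0] by linarith
    qed
    finally have "B * (\<Sum>j<p. c (Suc j)) \<le> B * suminf c" using B by (rule mult_left_mono)
    thus ?thesis using partial [of p] by linarith
  qed
  have "(\<lambda>p. g (p + n)) \<longlonglongrightarrow> f s"
  proof (rule LIMSEQ_ignore_initial_segment)
    show "g \<longlonglongrightarrow> f s" unfolding g_def by (rule dyadic_value_tendsto [OF f s])
  qed
  hence "(\<lambda>p. \<bar>g (p + n) - g n\<bar>) \<longlonglongrightarrow> \<bar>f s - g n\<bar>" by (intro tendsto_intros)
  hence "\<bar>f s - g n\<bar> \<le> B * suminf c"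
    by (rule LIMSEQ_le_const2) (use bound in \<open>auto simp: add.commute\<close>)
  thus ?thesis by (simp add: g_def B_def c_def)
qed

lemma dyadic_scale:
  assumes "1 \<le> (x::real)" obtains n where "x \<le> 2 ^ n" "2 ^ n < 2 * x"
proof -
  define n where "n = (LEAST n. x \<le> 2 ^ n)"
  have ex: "\<exists>n. x \<le> 2 ^ n" using real_arch_pow [of 2 x] by (auto intro: less_imp_le)
  have 1: "x \<le> 2 ^ n" unfolding n_def using ex by (rule LeastI_ex)
  have "2 ^ n < 2 * x"
  proof (cases n)
    case 0 thus ?thesis using assms by simp
  next
    case (Suc k)
    have "\<not> x \<le> 2 ^ k" using not_less_Least [of k "\<lambda>n. x \<le> 2 ^ n"] Suc by (auto simp: n_def)
    thus ?thesis using Suc by simp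
  qed
  thus ?thesis using 1 that by blast
qed

text \<open>The grid of mesh \<open>1 / 2 ^ n\<close> is chosen finer than the scale \<open>h\<close> by a factor between \<open>K\<close> and
\<open>2 * K\<close>. The grid points below \<open>s\<close> and \<open>t\<close> are then at most \<open>2 * K\<close> steps apart and their increment is
controlled with the sharp constant \<open>e\<close>; the two chaining errors carry \<open>\<phi> (h / K)\<close>, which is much smaller
than \<open>\<phi> h\<close> when \<open>K\<close> is large.\<close>

lemma dyadic_modulus:
  fixes f \<phi> :: "real \<Rightarrow> real" and K :: nat
  assumes f: "continuous_on {0..1} f" and \<phi>: "mono_on {0..1} \<phi>" and \<phi>pos: "\<And>x. 0 < x \<Longrightarrow> x \<le> 1 \<Longrightarrow> 0 < \<phi> x"
    and e: "0 \<le> e" and K: "1 \<le> K" and r: "0 < r" "r < 1"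
    and half: "\<And>x. 0 < x \<Longrightarrow> x \<le> x0 \<Longrightarrow> \<phi> (x / 2) \<le> r * \<phi> x"
    and inc: "\<And>m i k. n0 \<le> m \<Longrightarrow> 1 \<le> k \<Longrightarrow> k \<le> 2 * K \<Longrightarrow> i + k \<le> 2 ^ m \<Longrightarrow>
      \<bar>f (real (i + k) / 2 ^ m) - f (real i / 2 ^ m)\<bar> \<le> e * \<phi> (real k / 2 ^ m) * sqrt (real m * ln 2)"
    and h: "0 < h" "h * (1 + 1 / real K) \<le> 1" "h / real K \<le> x0" "h \<le> 1 / 2" "2 ^ n0 * h \<le> real K"
    and st: "s \<in> {0..1}" "t \<in> {0..1}" "\<bar>s - t\<bar> \<le> h"
  shows "\<bar>f s - f t\<bar> \<le> e * (\<phi> (h * (1 + 1 / real K)) + 2 * (\<Sum>j. r ^ j * sqrt (1 + real j)) * \<phi> (h / real K)) * sqrt (ln (2 * real K / h))"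
proof -
  have K0: "0 < real K" using K by simp
  have hK: "1 \<le> real K / h" using h K by (simp add: field_simps)
  obtain n where n: "real K / h \<le> 2 ^ n" "2 ^ n < 2 * (real K / h)" using dyadic_scale [OF hK] .
  have hn: "real K / 2 ^ n \<le> h" using n(1) h by (simp add: field_simps)
  have n1: "1 \<le> n"
  proof (rule ccontr)
    assume "\<not> 1 \<le> n"
    hence "n = 0" by simp
    hence "real K \<le> h" using n(1) h by (simp add: field_simps)
    moreover have "1 \<le> real K" using K by simp
    ultimately show False using h(4) by linarith
  qed
  have nn0: "n0 \<le> n"
  proof -
    have "2 ^ n0 \<le> real K / h" using h by (simp add: field_simps)
    hence "(2::real) ^ n0 \<le> 2 ^ n" using n(1) by linarith
    thus ?thesis by simp
  qed
  define C where "C = (\<Sum>j. r ^ j * sqrt (1 + real j))"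
  have C: "0 \<le> C" unfolding C_def using r by (intro suminf_nonneg summable_geometric_sqrt) auto
  have ln: "real n * ln 2 \<le> ln (2 * real K / h)"
  proof -
    have "ln (2 ^ n) \<le> ln (2 * (real K / h))" using n(2) by (intro ln_mono) auto
    thus ?thesis by (simp add: ln_realpow)
  qed
  have l0: "0 \<le> real n * ln 2" by simp
  have sq: "sqrt (real n * ln 2) \<le> sqrt (ln (2 * real K / h))" using ln by (rule real_sqrt_le_mono)
  have inv: "1 / 2 ^ n \<le> h / real K" using hn K0 by (simp add: field_simps)
  have hK1: "h / real K \<le> 1" using h(4) K0 K by (simp add: field_simps)
  have \<phi>n: "\<phi> (1 / 2 ^ n) \<le> \<phi> (h / real K)"
    using inv hK1 h K0 by (intro mono_onD [OF \<phi>]) auto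
  have geo: "\<phi> (1 / 2 ^ (n + j)) \<le> r ^ j * \<phi> (1 / 2 ^ n)" for j
  proof (induction j)
    case (Suc j)
    have "(1::real) / 2 ^ (n + j) \<le> 1 / 2 ^ n" by (simp add: field_simps)
    hence "\<phi> (1 / 2 ^ (n + j) / 2) \<le> r * \<phi> (1 / 2 ^ (n + j))"
      using inv h(3) by (intro half) auto
    also have "\<dots> \<le> r * (r ^ j * \<phi> (1 / 2 ^ n))" using Suc.IH r by (intro mult_left_mono) auto
    finally show ?case by (simp add: mult_ac)
  qed simp
  have chain: "\<bar>f s - f (real (dyadic_index n s) / 2 ^ n)\<bar> \<le> e * C * \<phi> (h / real K) * sqrt (ln (2 * real K / h))"
    if s: "s \<in> {0..1}" for s
  proof -
    have "\<bar>f s - f (real (dyadic_index n s) / 2 ^ n)\<bar> \<le> e * \<phi> (1 / 2 ^ n) * sqrt (real n * ln 2) * C"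
      unfolding C_def
    proof (rule dyadic_chaining [OF f e n1 r geo])
      show "0 \<le> \<phi> (1 / 2 ^ (n + j))" for j by (rule less_imp_le, rule \<phi>pos) auto
      show "\<bar>f (real (Suc i) / 2 ^ m) - f (real i / 2 ^ m)\<bar> \<le> e * \<phi> (1 / 2 ^ m) * sqrt (real m * ln 2)"
        if "n \<le> m" "Suc i \<le> 2 ^ m" for m i
        using inc [of m 1 i] that nn0 K by simp
    qed (use s in auto)
    also have "\<dots> \<le> e * \<phi> (h / real K) * sqrt (ln (2 * real K / h)) * C"
      using e C \<phi>n sq \<phi>pos [of "h / real K"] hK1 h K0
      by (intro mult_right_mono mult_mono mult_left_mono) auto
    finally show ?thesis by (simp add: mult_ac)
  qed
  have mid: "\<bar>f (real (dyadic_index n s) / 2 ^ n) - f (real (dyadic_index n t) / 2 ^ n)\<bar>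
      \<le> e * \<phi> (h * (1 + 1 / real K)) * sqrt (ln (2 * real K / h))"
    if s: "s \<in> {0..1}" and t: "t \<in> {0..1}" and d: "\<bar>s - t\<bar> \<le> h" and le: "t \<le> s" for s t
  proof -
    have R0: "0 \<le> e * \<phi> (h * (1 + 1 / real K)) * sqrt (ln (2 * real K / h))"
      using e l0 ln \<phi>pos [of "h * (1 + 1 / real K)"] h K0 by (intro mult_nonneg_nonneg) (auto simp: add_pos_pos less_imp_le)
    define i where "i = dyadic_index n t"
    define k where "k = dyadic_index n s - dyadic_index n t"
    have le': "dyadic_index n t \<le> dyadic_index n s" unfolding dyadic_index_def using le by (intro nat_mono floor_mono) auto
    have ik: "dyadic_index n s = i + k" using le' by (simp add: i_def k_def)
    show ?thesis
    proof (cases "k = 0")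
      case True thus ?thesis using R0 by (simp add: ik i_def)
    next
      case False
      have "real k = real (dyadic_index n s) - real (dyadic_index n t)" using le' by (simp add: k_def of_nat_diff)
      also have "\<dots> < 2 ^ n * (s - t) + 1"
        using dyadic_bounds [of s n] dyadic_bounds [of t n] s t by (simp add: right_diff_distrib)
      also have "2 ^ n * (s - t) \<le> 2 ^ n * h" using d by (intro mult_left_mono) auto
      finally have k1: "real k < 2 ^ n * h + 1" by simp
      have "2 ^ n * h < 2 * real K" using n(2) h by (simp add: field_simps)
      hence "real k < real (2 * K + 1)" using k1 by simp
      hence k2: "k \<le> 2 * K" by (simp only: of_nat_less_iff)
      have "\<bar>f (real (i + k) / 2 ^ n) - f (real i / 2 ^ n)\<bar> \<le> e * \<phi> (real k / 2 ^ n) * sqrt (real n * ln 2)"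
        using False k2 dyadic_le [of s n] s by (intro inc nn0) (auto simp: ik)
      also have "\<dots> \<le> e * \<phi> (h * (1 + 1 / real K)) * sqrt (ln (2 * real K / h))"
      proof -
        have "real k / 2 ^ n < h + 1 / 2 ^ n" using k1 by (simp add: field_simps)
        also have "\<dots> \<le> h * (1 + 1 / real K)" using inv by (simp add: algebra_simps)
        finally have le: "real k / 2 ^ n \<le> h * (1 + 1 / real K)" by simp
        have "0 \<le> real k / 2 ^ n" by simp
        hence "real k / 2 ^ n \<in> {0..1}" "h * (1 + 1 / real K) \<in> {0..1}"
          unfolding atLeastAtMost_iff using le h(2) by linarith+
        hence "\<phi> (real k / 2 ^ n) \<le> \<phi> (h * (1 + 1 / real K))"
          using le by (rule mono_onD [OF \<phi>])
        moreover have "0 \<le> \<phi> (h * (1 + 1 / real K))" using \<phi>pos [of "h * (1 + 1 / real K)"] h K0 by (simp add: add_pos_pos less_imp_le)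
        ultimately show ?thesis using e sq l0 by (intro mult_mono mult_left_mono mult_nonneg_nonneg) auto
      qed
      finally show ?thesis by (simp add: ik i_def)
    qed
  qed
  have mid': "\<bar>f (real (dyadic_index n s) / 2 ^ n) - f (real (dyadic_index n t) / 2 ^ n)\<bar>
      \<le> e * \<phi> (h * (1 + 1 / real K)) * sqrt (ln (2 * real K / h))"
    using mid [of s t] mid [of t s] st by (cases "t \<le> s") (auto simp: abs_minus_commute)
  have "\<bar>f s - f t\<bar> \<le> \<bar>f s - f (real (dyadic_index n s) / 2 ^ n)\<bar> + \<bar>f (real (dyadic_index n s) / 2 ^ n) - f (real (dyadic_index n t) / 2 ^ n)\<bar>
     + \<bar>f t - f (real (dyadic_index n t) / 2 ^ n)\<bar>" by linarith
  also have "\<dots> \<le> e * C * \<phi> (h / real K) * sqrt (ln (2 * real K / h)) + e * \<phi> (h * (1 + 1 / real K)) * sqrt (ln (2 * real K / h))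
     + e * C * \<phi> (h / real K) * sqrt (ln (2 * real K / h))"
    by (intro add_mono chain mid' st)
  finally show ?thesis unfolding C_def [symmetric] by (simp add: algebra_simps)
qed

section \<open>Increments over dyadic grids\<close>

text \<open>Borel-Cantelli over pairs of grid points at most \<open>2 * K\<close> steps apart. There are of order
\<open>2 ^ n\<close> such pairs, and by the tail bound each violates its threshold with probability of order
\<open>exp (- (1 - \<epsilon>) * e\<^sup>2 * n * ln 2)\<close>. The choice \<open>1 - \<epsilon> = 1 / e\<close> turns this into \<open>2 powr (- e * n)\<close>, and \<open>e > 1\<close>
makes the sum over \<open>n\<close> converge. This is where the constant 1 in front of the square root of the logarithm
comes from.\<close>

lemma dyadic_increments_AE:
  fixes K :: nat
  assumes M: "prob_space M" and \<alpha>: "0 < \<alpha>" and P: "permanental_process M \<alpha> {0..1} X u"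
    and \<phi>pos: "\<And>x. 0 < x \<Longrightarrow> x \<le> 1 \<Longrightarrow> 0 < \<phi> x"
    and \<sigma>: "\<forall>s\<in>{0..1}. \<forall>t\<in>{0..1}. sigma_function u s t \<le> \<phi> \<bar>t - s\<bar>" and e: "1 < e"
  shows "AE \<omega> in M. \<forall>\<^sub>F n in sequentially. \<forall>k i. 1 \<le> k \<longrightarrow> k \<le> 2 * K \<longrightarrow> i + k \<le> 2 ^ n \<longrightarrow>
     \<bar>sqrt (X (real (i + k) / 2 ^ n) \<omega>) - sqrt (X (real i / 2 ^ n) \<omega>)\<bar> \<le> e * \<phi> (real k / 2 ^ n) * sqrt (real n * ln 2)"
proof -
  interpret prob_space M by (rule M)
  define \<epsilon> where "\<epsilon> = 1 - 1 / e"
  have \<epsilon>: "0 < \<epsilon>" "\<epsilon> < 1" "1 - \<epsilon> = 1 / e" using e by (auto simp: \<epsilon>_def)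
  define I where "I = (\<lambda>n :: nat. {(k, i). 1 \<le> k \<and> k \<le> 2 * K \<and> i + k \<le> 2 ^ n})"
  define B where "B = (\<lambda>n (k, i). {\<omega> \<in> space M. e * \<phi> (real k / 2 ^ n) * sqrt (real n * ln 2) <
     \<bar>sqrt (X (real (i + k) / 2 ^ n) \<omega>) - sqrt (X (real i / 2 ^ n) \<omega>)\<bar>})"
  \<comment> \<open>At n = 0 the threshold is 0, outside the range of the tail bound.\<close>
  define A where "A = (\<lambda>n. if n = 0 then {} else (\<Union>p\<in>I n. B n p))"
  have sub: "I n \<subseteq> {..2 * K} \<times> {..2 ^ n}" for n by (auto simp: I_def)
  have fin: "finite (I n)" for n using finite_subset [OF sub] by simp
  have pts: "real (i + k) / 2 ^ n \<in> {0..1}" "real i / 2 ^ n \<in> {0..1}" "real k / 2 ^ n \<le> 1" if "(k, i) \<in> I n" for n k i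
  proof -
    have "real (i + k) \<le> real (2 ^ n)" using that by (subst of_nat_le_iff) (simp add: I_def)
    hence "real i + real k \<le> 2 ^ n" by simp
    moreover from this have "real i \<le> 2 ^ n" "real k \<le> 2 ^ n" by linarith+
    ultimately show "real (i + k) / 2 ^ n \<in> {0..1}" "real i / 2 ^ n \<in> {0..1}" "real k / 2 ^ n \<le> 1" by auto
  qed
  note m = permanental_process_single(1) [OF P]
  have Bs: "B n p \<in> sets M" if "p \<in> I n" for n p
  proof (cases p)
    case (Pair k i)
    have [measurable]: "X (real (i + k) / 2 ^ n) \<in> borel_measurable M" "X (real i / 2 ^ n) \<in> borel_measurable M"
      using m pts that Pair by auto
    show ?thesis unfolding B_def Pair prod.case by measurable
  qed
  define D where "D = 2 * \<epsilon> powr (- 2 * \<alpha>)"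
  have D: "0 \<le> D" by (simp add: D_def)
  have Bm: "measure M (B n p) \<le> D * exp (- e * (real n * ln 2))" if p: "p \<in> I n" and n: "n \<noteq> 0" for n p
  proof (cases p)
    case (Pair k i)
    define \<tau> where "\<tau> = \<phi> (real k / 2 ^ n)"
    define l where "l = real n * ln 2"
    have l: "0 < l" using n by (simp add: l_def)
    have k: "1 \<le> k" using p Pair by (simp add: I_def)
    have \<tau>: "0 < \<tau>" unfolding \<tau>_def using pts p Pair k by (intro \<phi>pos) auto
    have "\<bar>real i / 2 ^ n - real (i + k) / 2 ^ n\<bar> = real k / 2 ^ n"
      by (simp add: diff_divide_distrib [symmetric])
    hence s: "sigma_function u (real (i + k) / 2 ^ n) (real i / 2 ^ n) \<le> \<tau>"
      using \<sigma> pts p Pair unfolding \<tau>_def by metis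
    have "measure M (B n p) \<le> 2 * \<epsilon> powr (- 2 * \<alpha>) * exp (- (1 - \<epsilon>) * (e * \<tau> * sqrt l)\<^sup>2 / \<tau>\<^sup>2)"
      unfolding B_def Pair prod.case \<tau>_def [symmetric] l_def [symmetric] 
      using pts p Pair \<tau> e l by (intro permanental_increment_tail [OF M \<alpha> P _ _ \<tau> s _ \<epsilon>(1,2)]) auto
    also have "- (1 - \<epsilon>) * (e * \<tau> * sqrt l)\<^sup>2 / \<tau>\<^sup>2 = - e * l"
      unfolding \<epsilon>(3) using \<tau> e l by (simp add: power_mult_distrib power2_eq_square)
    finally show ?thesis by (simp add: D_def l_def)
  qed
  define q where "q = exp (- (e - 1) * ln 2)"
  have "- (e - 1) * ln 2 < 0" using e by (intro mult_neg_pos) auto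
  hence q: "0 < q" "q < 1" by (simp_all only: q_def exp_less_one_iff exp_gt_zero)
  have Am: "measure M (A n) \<le> (2 * real K + 1) * 2 * D * q ^ n" for n
  proof (cases "n = 0")
    case True thus ?thesis using D q by (simp add: A_def)
  next
    case False
    have "measure M (A n) \<le> (\<Sum>p\<in>I n. measure M (B n p))"
      using False Bs fin by (simp add: A_def measure_UNION_le)
    also have "\<dots> \<le> (\<Sum>p\<in>I n. D * exp (- e * (real n * ln 2)))" using Bm False by (intro sum_mono) auto
    also have "\<dots> = real (card (I n)) * (D * exp (- e * (real n * ln 2)))" by simp
    also have "\<dots> \<le> ((2 * real K + 1) * (2 * 2 ^ n)) * (D * exp (- e * (real n * ln 2)))"
    proof (intro mult_right_mono)
      have "card (I n) \<le> card ({..2 * K} \<times> {..2 ^ n :: nat})" by (intro card_mono sub) auto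
      also have "\<dots> = (2 * K + 1) * (2 ^ n + 1)" by (simp add: card_cartesian_product)
      finally have "real (card (I n)) \<le> real ((2 * K + 1) * (2 ^ n + 1))" by (simp only: of_nat_le_iff)
      also have "\<dots> = (2 * real K + 1) * (2 ^ n + 1)" by (simp add: algebra_simps)
      also have "\<dots> \<le> (2 * real K + 1) * (2 * 2 ^ n)" by (intro mult_left_mono) auto
      finally show "real (card (I n)) \<le> (2 * real K + 1) * (2 * 2 ^ n)" .
    qed (use D in auto)
    also have "\<dots> = (2 * real K + 1) * 2 * D * (2 ^ n * exp (- e * (real n * ln 2)))" by simp
    also have "2 ^ n * exp (- e * (real n * ln 2)) = q ^ n"
    proof -
      have "(2::real) ^ n = exp (real n * ln 2)" by (simp add: exp_of_nat_mult)
      thus ?thesis unfolding q_def exp_of_nat_mult [symmetric] by (simp add: mult_exp_exp algebra_simps)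
    qed
    finally show ?thesis .
  qed
  have "AE \<omega> in M. eventually (\<lambda>n. \<omega> \<in> space M - A n) sequentially"
  proof (rule borel_cantelli_AE1)
    show "A n \<in> sets M" for n using Bs fin by (auto simp: A_def)
    show "emeasure M (A n) < \<infinity>" for n by (simp add: less_top [symmetric])
    show "summable (\<lambda>n. measure M (A n))"
    proof (rule summable_comparison_test)
      show "\<exists>N. \<forall>n\<ge>N. norm (measure M (A n)) \<le> (2 * real K + 1) * 2 * D * q ^ n" using Am by auto
      show "summable (\<lambda>n. (2 * real K + 1) * 2 * D * q ^ n)" using q by (intro summable_mult summable_geometric) auto
    qed
  qed
  thus ?thesis
  proof eventually_elim
    case (elim \<omega>)
    thus ?case using eventually_gt_at_top [of 0]
    proof eventually_elim
      case (elim n)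
      thus ?case by (force simp: A_def B_def I_def not_less)
    qed
  qed
qed

section \<open>The modulus of continuity\<close>

text \<open>Dividing the bound of \<open>dyadic_modulus\<close> by \<open>\<phi> h * sqrt (ln (1 / h))\<close> and letting \<open>h\<close> tend to 0, regular
variation gives the limit \<open>e * ((1 + 1 / K) powr \<rho> + 2 * C * (1 / K) powr \<rho>)\<close>. With \<open>e = 1 + 1 / K\<close> it tends
to 1 as \<open>K\<close> grows, because \<open>\<rho> > 0\<close>; so one large \<open>K\<close> suffices for a given \<open>\<gamma>\<close>.\<close>

lemma regular_modulus:
  fixes f \<phi> :: "real \<Rightarrow> real"
  assumes f: "continuous_on {0..1} f" and \<phi>: "mono_on {0..1} \<phi>" and \<phi>pos: "\<And>x. 0 < x \<Longrightarrow> x \<le> 1 \<Longrightarrow> 0 < \<phi> x"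
    and \<rho>: "0 < \<rho>" and rv: "regularly_varying_at_zero \<phi> \<rho>"
    and inc: "\<And>j. \<forall>\<^sub>F n in sequentially. \<forall>k i. 1 \<le> k \<longrightarrow> k \<le> 2 * Suc j \<longrightarrow> i + k \<le> 2 ^ n \<longrightarrow>
      \<bar>f (real (i + k) / 2 ^ n) - f (real i / 2 ^ n)\<bar> \<le> (1 + 1 / real (Suc j)) * \<phi> (real k / 2 ^ n) * sqrt (real n * ln 2)"
    and \<gamma>: "0 < \<gamma>"
  shows "\<forall>\<^sub>F h in at_right 0. \<forall>s\<in>{0..1}. \<forall>t\<in>{0..1}. \<bar>s - t\<bar> \<le> h \<longrightarrow> \<bar>f s - f t\<bar> \<le> (1 + \<gamma>) * (\<phi> h * sqrt (ln (1 / h)))"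
proof -
  have ratio: "((\<lambda>x. \<phi> (c * x) / \<phi> x) \<longlongrightarrow> c powr \<rho>) (at_right 0)" if "0 < c" for c
    using rv that by (simp add: regularly_varying_at_zero_def)
  \<comment> \<open>Any number strictly between (1/2) powr \<rho> and 1: the dyadic decay rate of \<phi> near 0.\<close>
  define r where "r = (1 + (1 / 2) powr \<rho>) / 2"
  have "(1 / 2 :: real) powr \<rho> < 1" using \<rho> powr_less_mono2 [of \<rho> "1 / 2" 1] by simp
  hence r: "0 < r" "r < 1" "(1 / 2) powr \<rho> < r" by (auto simp: r_def add_pos_nonneg)
  obtain x0 where x0: "0 < x0" and half: "\<And>x. 0 < x \<Longrightarrow> x \<le> x0 \<Longrightarrow> \<phi> (x / 2) \<le> r * \<phi> x"
  proof -
    have "\<forall>\<^sub>F x in at_right 0. \<phi> (1 / 2 * x) / \<phi> x < r"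
      using order_tendstoD(2) [OF ratio [of "1 / 2"] r(3)] by simp
    moreover have "\<forall>\<^sub>F x in at_right (0::real). x \<in> {0<..<1}" by (rule eventually_at_right_real) simp
    ultimately have "\<forall>\<^sub>F x in at_right 0. \<phi> (x / 2) \<le> r * \<phi> x"
    proof eventually_elim
      case (elim x)
      have "0 < \<phi> x" using elim by (intro \<phi>pos) auto
      thus ?case using elim by (simp add: field_simps)
    qed
    then obtain b where b: "0 < b" "\<And>x. 0 < x \<Longrightarrow> x < b \<Longrightarrow> \<phi> (x / 2) \<le> r * \<phi> x"
      by (auto simp: eventually_at_right_field)
    show ?thesis by (rule that [of "b / 2"]) (use b in auto)
  qed
  define C where "C = (\<Sum>j. r ^ j * sqrt (1 + real j))"
  define L where "L = (\<lambda>j. (1 + 1 / real (Suc j)) * ((1 + 1 / real (Suc j)) powr \<rho> + 2 * C * (1 / real (Suc j)) powr \<rho>))"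
  have z: "(\<lambda>j. 1 / real (Suc j)) \<longlonglongrightarrow> 0"
    using LIMSEQ_inverse_real_of_nat by (simp add: inverse_eq_divide)
  have "(\<lambda>j. (1 / real (Suc j)) powr \<rho>) \<longlonglongrightarrow> 0"
    using \<rho> by (intro tendsto_zero_powrI [OF z tendsto_const]) auto
  hence "L \<longlonglongrightarrow> (1 + 0) * ((1 + 0) powr \<rho> + 2 * C * 0)"
    unfolding L_def by (intro tendsto_intros z) auto
  hence "\<forall>\<^sub>F j in sequentially. L j < 1 + \<gamma>" using \<gamma> by (intro order_tendstoD(2)) auto
  then obtain j where j: "L j < 1 + \<gamma>" by (auto simp: eventually_sequentially)
  define K where "K = Suc j"
  define e where "e = 1 + 1 / real K"
  have K: "1 \<le> K" "0 < real K" "1 \<le> real K" by (auto simp: K_def)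
  define G where "G = (\<lambda>h. e * (\<phi> (h * (1 + 1 / real K)) + 2 * C * \<phi> (h / real K)) * sqrt (ln (2 * real K / h)))"
  have G: "((\<lambda>h. G h / (\<phi> h * sqrt (ln (1 / h)))) \<longlongrightarrow> L j) (at_right 0)"
  proof -
    have "((\<lambda>h. sqrt (ln (2 * real K / h)) / sqrt (ln (1 / h))) \<longlongrightarrow> 1) (at_right 0)"
      using K(2) by real_asymp
    hence "((\<lambda>h. e * (\<phi> ((1 + 1 / real K) * h) / \<phi> h + 2 * C * (\<phi> (1 / real K * h) / \<phi> h)) * (sqrt (ln (2 * real K / h)) / sqrt (ln (1 / h))))
      \<longlongrightarrow> e * ((1 + 1 / real K) powr \<rho> + 2 * C * (1 / real K) powr \<rho>) * 1) (at_right 0)"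
      using K by (intro tendsto_intros ratio) (auto simp: add_pos_pos)
    moreover have "(\<lambda>h. e * (\<phi> ((1 + 1 / real K) * h) / \<phi> h + 2 * C * (\<phi> (1 / real K * h) / \<phi> h)) * (sqrt (ln (2 * real K / h)) / sqrt (ln (1 / h))))
      = (\<lambda>h. G h / (\<phi> h * sqrt (ln (1 / h))))"
      by (rule ext) (simp add: G_def add_divide_distrib mult_ac distrib_left)
    moreover have "e * ((1 + 1 / real K) powr \<rho> + 2 * C * (1 / real K) powr \<rho>) * 1 = L j"
      by (simp add: L_def e_def K_def)
    ultimately show ?thesis by simp
  qed
  obtain n0 where n0: "\<And>m k i. n0 \<le> m \<Longrightarrow> 1 \<le> k \<Longrightarrow> k \<le> 2 * K \<Longrightarrow> i + k \<le> 2 ^ m \<Longrightarrow>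
      \<bar>f (real (i + k) / 2 ^ m) - f (real i / 2 ^ m)\<bar> \<le> e * \<phi> (real k / 2 ^ m) * sqrt (real m * ln 2)"
    using inc [of j] unfolding eventually_sequentially K_def [symmetric] e_def [symmetric] by blast
  define b where "b = min (1 / 2) (min x0 (real K / 2 ^ n0))"
  have b: "0 < b" using x0 K by (simp add: b_def)
  have "\<forall>\<^sub>F h in at_right 0. G h / (\<phi> h * sqrt (ln (1 / h))) < 1 + \<gamma>"
    using order_tendstoD(2) [OF G j] .
  moreover have "\<forall>\<^sub>F h in at_right 0. h \<in> {0<..<b}" using b by (rule eventually_at_right_real)
  ultimately show ?thesis
  proof eventually_elim
    case (elim h)
    have h: "0 < h" "h < 1 / 2" "h < x0" "h < real K / 2 ^ n0" using elim by (auto simp: b_def)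
    have pos: "0 < \<phi> h * sqrt (ln (1 / h))" using h by (intro mult_pos_pos \<phi>pos) (auto simp: ln_gt_zero_iff)
    show ?case
    proof (intro ballI impI)
      fix s t assume st: "s \<in> {0..1}" "t \<in> {0..1}" "\<bar>s - t\<bar> \<le> h"
      have "\<bar>f s - f t\<bar> \<le> G h" unfolding G_def C_def
      proof (rule dyadic_modulus [OF f \<phi> \<phi>pos _ K(1) r(1,2) half n0])
        have "h * (1 / real K) \<le> h * 1" using h K by (intro mult_left_mono) auto
        thus "h * (1 + 1 / real K) \<le> 1" "h / real K \<le> x0" using h by (auto simp: distrib_left)
        show "2 ^ n0 * h \<le> real K" using h by (simp add: field_simps)
      qed (use h st in \<open>auto simp: e_def\<close>)
      also have "\<dots> \<le> (1 + \<gamma>) * (\<phi> h * sqrt (ln (1 / h)))" using elim pos by (simp add: pos_divide_less_eq)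
      finally show "\<bar>f s - f t\<bar> \<le> (1 + \<gamma>) * (\<phi> h * sqrt (ln (1 / h)))" .
    qed
  qed
qed

lemma nonneg_of_dyadic_nonneg:
  assumes f: "continuous_on {0..1} f" and d: "\<And>n i. i \<le> 2 ^ n \<Longrightarrow> 0 \<le> f (real i / 2 ^ n)" and s: "s \<in> {0..1}"
  shows "0 \<le> (f s :: real)"
proof (rule LIMSEQ_le_const)
  show "(\<lambda>n. f (real (dyadic_index n s) / 2 ^ n)) \<longlonglongrightarrow> f s"
    by (rule dyadic_value_tendsto [OF f]) (use s in auto)
  show "\<exists>N. \<forall>n\<ge>N. 0 \<le> f (real (dyadic_index n s) / 2 ^ n)" using d dyadic_le s by auto
qed

text \<open>From the square root to the process itself:
\<open>x s - x t = (sqrt (x s) - sqrt (x t)) * (sqrt (x s) + sqrt (x t))\<close>, and the second factor is at most twice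
the supremum of \<open>sqrt (x t)\<close>. This is the factor 2 of the theorem.\<close>

lemma squared_modulus_Limsup:
  fixes x \<phi> :: "real \<Rightarrow> real"
  assumes x: "continuous_on {0..1} x" "\<And>t. t \<in> {0..1} \<Longrightarrow> 0 \<le> x t"
    and \<phi>pos: "\<And>x. 0 < x \<Longrightarrow> x \<le> 1 \<Longrightarrow> 0 < \<phi> x"
    and mod: "\<And>\<gamma>. 0 < \<gamma> \<Longrightarrow> \<forall>\<^sub>F h in at_right 0. \<forall>s\<in>{0..1}. \<forall>t\<in>{0..1}. \<bar>s - t\<bar> \<le> h \<longrightarrow>
      \<bar>sqrt (x s) - sqrt (x t)\<bar> \<le> (1 + \<gamma>) * (\<phi> h * sqrt (ln (1 / h)))"
  shows "Limsup (at_right 0)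
      (\<lambda>h. SUP (s, t)\<in>{(s, t). s \<in> {0..1} \<and> t \<in> {0..1} \<and> \<bar>s - t\<bar> \<le> h}.
         ereal (\<bar>x s - x t\<bar> / (\<phi> h * sqrt (ln (1 / h)))))
    \<le> 2 * (SUP t\<in>{0..1}. ereal (sqrt (x t)))" (is "?L \<le> _")
proof -
  obtain t0 where t0: "t0 \<in> {0..1}" "\<And>t. t \<in> {0..1} \<Longrightarrow> x t \<le> x t0"
    using continuous_attains_sup [of "{0..1::real}" x] x(1) by auto
  define m where "m = sqrt (x t0)"
  have m: "0 \<le> m" "\<And>t. t \<in> {0..1} \<Longrightarrow> sqrt (x t) \<le> m" using t0 x by (auto simp: m_def)
  have L: "?L \<le> ereal (2 * (1 + \<gamma>) * m)" if \<gamma>: "0 < \<gamma>" for \<gamma>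
  proof (rule Limsup_bounded)
    have "\<forall>\<^sub>F h in at_right (0::real). h \<in> {0<..<1}" by (rule eventually_at_right_real) simp
    with mod [OF \<gamma>] show "\<forall>\<^sub>F h in at_right 0. (SUP (s, t)\<in>{(s, t). s \<in> {0..1} \<and> t \<in> {0..1} \<and> \<bar>s - t\<bar> \<le> h}.
         ereal (\<bar>x s - x t\<bar> / (\<phi> h * sqrt (ln (1 / h))))) \<le> ereal (2 * (1 + \<gamma>) * m)"
    proof eventually_elim
      case (elim h)
      have pos: "0 < \<phi> h * sqrt (ln (1 / h))" using elim by (intro mult_pos_pos \<phi>pos) (auto simp: ln_gt_zero_iff)
      show ?case
      proof (rule SUP_least, clarify)
        fix s t :: real assume st: "s \<in> {0..1}" "t \<in> {0..1}" "\<bar>s - t\<bar> \<le> h"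
        have "x s - x t = (sqrt (x s) - sqrt (x t)) * (sqrt (x s) + sqrt (x t))"
          using x(2) st by (simp add: algebra_simps)
        hence "\<bar>x s - x t\<bar> = \<bar>sqrt (x s) - sqrt (x t)\<bar> * (sqrt (x s) + sqrt (x t))"
          using x(2) st by (simp add: abs_mult)
        also have "\<dots> \<le> ((1 + \<gamma>) * (\<phi> h * sqrt (ln (1 / h)))) * (2 * m)"
        proof (intro mult_mono)
          show "\<bar>sqrt (x s) - sqrt (x t)\<bar> \<le> (1 + \<gamma>) * (\<phi> h * sqrt (ln (1 / h)))" using elim st by blast
          show "sqrt (x s) + sqrt (x t) \<le> 2 * m" using m(2) [OF st(1)] m(2) [OF st(2)] by simp
          show "0 \<le> (1 + \<gamma>) * (\<phi> h * sqrt (ln (1 / h)))" using \<gamma> pos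
            by (intro mult_nonneg_nonneg [of "1 + \<gamma>" "\<phi> h * sqrt (ln (1 / h))"]) linarith+
          show "0 \<le> sqrt (x s) + sqrt (x t)" using x(2) st by auto
        qed
        finally have "\<bar>x s - x t\<bar> \<le> 2 * (1 + \<gamma>) * m * (\<phi> h * sqrt (ln (1 / h)))" by (simp add: algebra_simps)
        thus "ereal (\<bar>x s - x t\<bar> / (\<phi> h * sqrt (ln (1 / h)))) \<le> ereal (2 * (1 + \<gamma>) * m)"
          using pos by (simp only: ereal_less_eq pos_divide_le_eq)
      qed
    qed
  qed
  have "(\<lambda>j. ereal (2 * (1 + 1 / real (Suc j)) * m)) \<longlonglongrightarrow> ereal (2 * (1 + 0) * m)"
  proof -
    have z: "(\<lambda>j. 1 / real (Suc j)) \<longlonglongrightarrow> 0"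
      using LIMSEQ_inverse_real_of_nat by (simp add: inverse_eq_divide)
    show ?thesis unfolding lim_ereal by (intro tendsto_intros z)
  qed
  hence "?L \<le> ereal (2 * (1 + 0) * m)" by (rule LIMSEQ_le_const) (intro exI [of _ 0] allI impI L, simp)
  also have "\<dots> = 2 * ereal m" by simp
  also have "\<dots> \<le> 2 * (SUP t\<in>{0..1}. ereal (sqrt (x t)))"
    using t0(1) unfolding m_def by (intro ereal_mult_left_mono SUP_upper) auto
  finally show ?thesis .
qed

theorem theorem1p3:
  fixes M :: "'w measure"
    and \<alpha> :: real
    and X :: "real \<Rightarrow> 'w \<Rightarrow> real"
    and u :: "real \<Rightarrow> real \<Rightarrow> real"
    and \<phi> :: "real \<Rightarrow> real"
    and \<rho> :: real
  assumes "prob_space M"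
    and "0 < \<alpha>"
    and "permanental_process M \<alpha> {0..1} X u"
    and "AE \<omega> in M. continuous_on {0..1} (\<lambda>t. X t \<omega>)"
    and "\<forall>\<delta>>0. 0 < (SUP t\<in>{t \<in> {0..1}. t \<le> \<delta>}. ereal (u t t))"
    and "mono_on {0..1} \<phi>"
    and "\<forall>s\<in>{0..1}. \<forall>t\<in>{0..1}. sigma_function u s t \<le> \<phi> \<bar>t - s\<bar>"
    and "(\<integral>\<^sup>+x\<in>{0<..1/2}. ennreal (\<phi> x / (x * sqrt (ln (1 / x)))) \<partial>lborel) < \<infinity>"
    and "0 < \<rho>"
    and "regularly_varying_at_zero \<phi> \<rho>"
  shows "AE \<omega> in M.
    Limsup (at_right 0)
      (\<lambda>h. SUP (s, t)\<in>{(s, t). s \<in> {0..1} \<and> t \<in> {0..1} \<and> \<bar>s - t\<bar> \<le> h}.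
         ereal (\<bar>X s \<omega> - X t \<omega>\<bar> / (\<phi> h * sqrt (ln (1 / h)))))
    \<le> 2 * (SUP t\<in>{0..1}. ereal (sqrt (X t \<omega>)))"
proof -
  have \<phi>pos: "0 < \<phi> x" if x: "0 < x" "x \<le> 1" for x
  proof -
    have "\<forall>\<^sub>F y in at_right 0. 0 < \<phi> y" using assms(10) by (simp add: regularly_varying_at_zero_def)
    moreover have "\<forall>\<^sub>F y in at_right 0. y \<in> {0<..<x}" using x(1) by (rule eventually_at_right_real)
    ultimately have "\<forall>\<^sub>F y in at_right (0::real). 0 < \<phi> x"
    proof eventually_elim
      case (elim y)
      thus ?case using mono_onD [OF assms(6), of y x] x by auto
    qed
    thus ?thesis by simp
  qed
  have "AE \<omega> in M. \<forall>j. \<forall>\<^sub>F n in sequentially. \<forall>k i. 1 \<le> k \<longrightarrow> k \<le> 2 * Suc j \<longrightarrow> i + k \<le> 2 ^ n \<longrightarrow>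
     \<bar>sqrt (X (real (i + k) / 2 ^ n) \<omega>) - sqrt (X (real i / 2 ^ n) \<omega>)\<bar>
       \<le> (1 + 1 / real (Suc j)) * \<phi> (real k / 2 ^ n) * sqrt (real n * ln 2)"
    unfolding AE_all_countable
    by (intro allI dyadic_increments_AE [OF assms(1,2,3) \<phi>pos assms(7)]) auto
  moreover have "AE \<omega> in M. \<forall>n. \<forall>i. i \<le> 2 ^ n \<longrightarrow> 0 \<le> X (real i / 2 ^ n) \<omega>"
    unfolding AE_all_countable
  proof (intro allI)
    fix n i :: nat
    show "AE \<omega> in M. i \<le> 2 ^ n \<longrightarrow> 0 \<le> X (real i / 2 ^ n) \<omega>"
    proof (cases "i \<le> 2 ^ n")
      case True
      hence "real i \<le> real (2 ^ n)" by (simp only: of_nat_le_iff)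
      hence "real i / 2 ^ n \<in> {0..1}" by simp
      from permanental_process_single(2) [OF assms(3) this] show ?thesis by eventually_elim simp
    qed simp
  qed
  ultimately show ?thesis using assms(4)
  proof eventually_elim
    case (elim \<omega>)
    have nn: "0 \<le> X t \<omega>" if "t \<in> {0..1}" for t
      by (rule nonneg_of_dyadic_nonneg [OF elim(3) _ that]) (use elim(2) in auto)
    show ?case
    proof (rule squared_modulus_Limsup [OF elim(3) nn \<phi>pos])
      have c: "continuous_on {0..1} (\<lambda>t. sqrt (X t \<omega>))" using elim(3) by (intro continuous_intros)
      fix \<gamma> :: real assume "0 < \<gamma>"
      thus "\<forall>\<^sub>F h in at_right 0. \<forall>s\<in>{0..1}. \<forall>t\<in>{0..1}. \<bar>s - t\<bar> \<le> h \<longrightarrow>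
          \<bar>sqrt (X s \<omega>) - sqrt (X t \<omega>)\<bar> \<le> (1 + \<gamma>) * (\<phi> h * sqrt (ln (1 / h)))"
        using elim(1) by (intro regular_modulus [OF c assms(6) \<phi>pos assms(9,10)]) auto
    qed
  qed
qed

end
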